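(* Let $(\mathcal H,V,\mathfrak h)=(\mathcal G,V^{\mathcal G},\mathfrak g)\oplus_\gamma(\mathcal K,V^{\mathcal K},\mathfrak k)$ be a $\gamma$-extension of processes. Let $\mathcal U_0^{\mathcal G}\subset\mathcal E^{\mathfrak g}$ and $\mathcal Y_0^{\mathcal G}\subset\mathfrak g\oplus\mathcal E^{\mathfrak g}$ be input and output spaces represented by $(\mathcal G,V^{\mathcal G},\mathfrak g)$, with represented structure maps $(A^{\mathcal G},B^{\mathcal G},C^{\mathcal G},D^{\mathcal G})$, and let $\mathcal U_0^{\mathcal K}\subset\mathcal E^{\mathfrak k}$ and $\mathcal Y_0^{\mathcal K}\subset\mathfrak k\oplus\mathcal E^{\mathfrak k}$ be input and output spaces represented by $(\mathcal K,V^{\mathcal K},\mathfrak k)$, with represented structure maps $(A^{\mathcal K},B^{\mathcal K},C^{\mathcal K},D^{\mathcal K})$. Let $(A,B,C,D)$ be the structure maps represented by $(\mathcal H,V,\mathfrak h)$ with output space $\mathcal Y_0:=\mathcal Y_0^{\mathcal G}$ and input space $\mathcal U_0:=\mathcal U_0^{\mathcal K}$, and let $$\Gamma:=P_{\mathcal U_0^{\mathcal G}}|_{\mathcal Y_0^{\mathcal K}}:\mathcal Y_0^{\mathcal K}\to\mathcal U_0^{\mathcal G}.$$ Suppose that $\mathcal U_0^{\mathcal G}$ is a left support and $\mathcal Y_0^{\mathcal K}$ is a right support of $\gamma$. Then $(A,B,C,D)$ is a $\Gamma$-cascade of $(A^{\mathcal K},B^{\mathcal K},C^{\mathcal K},D^{\mathcal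 K})$ and $(A^{\mathcal G},B^{\mathcal G},C^{\mathcal G},D^{\mathcal G})$; explicitly, with respect to $\mathfrak h=\mathfrak k\oplus\mathfrak g$ and for $j=1,\dots,d$, $$A_j=\begin{pmatrix} A_j^{\mathcal K} & 0 \\ B_j^{\mathcal G}\,\Gamma\,C^{\mathcal K} & A_j^{\mathcal G} \end{pmatrix},\qquad B_j=\begin{pmatrix} B_j^{\mathcal K} \\ B_j^{\mathcal G}\,\Gamma\,D^{\mathcal K} \end{pmatrix},$$ $$C=\begin{pmatrix} D^{\mathcal G}\,\Gamma\,C^{\mathcal K} & C^{\mathcal G} \end{pmatrix},\qquad D=D^{\mathcal G}\,\Gamma\,D^{\mathcal K}.$$
   Context: Let $\mathcal P$ be a separable Hilbert space with orthonormal basis $(\epsilon_k)_{k=1}^d$ ($d\in\mathbb N$ or $d=\infty$), and let $F_d^+$ be the free semigroup of words in the letters $1,\dots,d$, including the empty word $0$. A row isometry on a separable Hilbert space $\mathcal H$ is an isometry $V:\mathcal H\otimes\mathcal P\to\mathcal H$; put $V_k\xi=V(\xi\otimes\epsilon_k)$ and $V_\alpha=V_{\alpha_1}\cdots V_{\alpha_n}$ for $\alpha=\alpha_1\dots\alpha_n$, $V_0=1$. A closed subspace $\mathfrak h$ is co-invariant for $V$ if $V_k^*\mathfrak h\subset\mathfrak h$ for all $k$. A process (= minimal discrete weak Markov process) is a triple $(\mathcal H,V,\mathfrak h)$ where $V$ is a row isometry on $\mathcal H$, $\mathfrak h\subset\mathcal H$ is a co-invariant closed subspace, and $\mathcal H=\overline{\mathrm{span}}\{V_\alpha\mathfrak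 h:\alpha\in F_d^+\}$. $P_{\mathcal L}$ is the orthogonal projection onto a closed subspace $\mathcal L$. For a process put $\mathcal E=\overline{\mathrm{span}}(\mathfrak h,V(\mathfrak h\otimes\mathcal P))\ominus\mathfrak h$; the analogous spaces for $(\mathcal G,V^{\mathcal G},\mathfrak g)$ and $(\mathcal K,V^{\mathcal K},\mathfrak k)$ are $\mathcal E^{\mathfrak g}$, $\mathcal E^{\mathfrak k}$. Also $\mathcal E^{\mathfrak k}_*=\overline{\mathrm{span}}(\mathfrak k,V^{\mathcal K}(\mathfrak k\otimes\mathcal P))\ominus V^{\mathcal K}(\mathfrak k\otimes\mathcal P)$. Structure maps represented by a process $(\mathcal H,V,\mathfrak h)$ with (closed) input space $\mathcal U_0\subset\mathcal E$ and output space $\mathcal Y_0\subset\mathfrak h\oplus\mathcal E$ (identifications suppressed): $A_j=V_j^*|_{\mathfrak h}:\mathfrak h\to\mathfrak h$, $B_j=V_j^*|_{\mathcal U_0}:\mathcal U_0\to\mathfrak h$, $C=P_{\mathcal Y_0}|_{\mathfrak h}:\mathfrak h\to\mathcal Y_0$, $D=P_{\mathcal Y_0}|_{\mathcal U_0}:\mathcal U_0\to\mathcal Y_0$; analogously for $(\mathcal G,V^{\mathcal G},\mathfrak g)$ and $(\mathcal K,V^{\mathcal K},\mathfrak k)$. $\gamma$-extension: let $\gamma:\mathcal E^{\mathfrak k}_*\to\mathcal E^{\mathfrak g}$ be a contraction, $D_{\gamma^*}=\sqrt{1-\gamma\gamma^*}$, $\mathcal D_{\gamma^*}$ the closure of its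 range. Then $(\mathcal G,V^{\mathcal G},\mathfrak g)\oplus_\gamma(\mathcal K,V^{\mathcal K},\mathfrak k)=(\mathcal H,V,\mathfrak h)$ with $\mathfrak h=\mathfrak g\oplus\mathfrak k$, $\mathcal H=\mathfrak g\oplus\mathcal K\oplus\bigoplus_{\alpha\in F_d^+}(\mathcal D_{\gamma^*})_\alpha$ (copies of $\mathcal D_{\gamma^*}$), and $V$ given on $\mathfrak g\otimes\mathcal P$ by $V=\big(1_{\mathfrak g}\oplus\binom{\gamma^*}{D_{\gamma^*}}\big)V^{\mathcal G}$ (where $V^{\mathcal G}(\mathfrak g\otimes\mathcal P)\subset\mathfrak g\oplus\mathcal E^{\mathfrak g}$, $\gamma^*:\mathcal E^{\mathfrak g}\to\mathcal E^{\mathfrak k}_*\subset\mathcal K$, $D_{\gamma^*}:\mathcal E^{\mathfrak g}\to(\mathcal D_{\gamma^*})_0$), on $\mathcal K\otimes\mathcal P$ by $V^{\mathcal K}$, and on the last summand by the canonical row shift ($V_k:(\mathcal D_{\gamma^*})_\alpha\to(\mathcal D_{\gamma^*})_{k\alpha}$ identically). It is a process. Inside $\mathcal H$, $\mathcal G$ is identified with $\overline{\mathrm{span}}\{V_\alpha\mathfrak g\}$, with $\mathfrak g$ embedded identically and $e\in\mathcal E^{\mathfrak g}$ identified with $\gamma^*e\oplus D_{\gamma^*}e\in\mathcal E^{\mathfrak k}_*\oplus(\mathcal D_{\gamma^*})_0$; then $\gamma=P_{\mathcal E^{\mathfrak g}}|_{\mathcal E^{\mathfrak k}_*}$, $\mathfrak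 g\oplus\mathcal E^{\mathfrak g}\subset\mathfrak h\oplus\mathcal E$ and $\mathcal E^{\mathfrak k}\subset\mathcal E$, so $\mathcal Y_0^{\mathcal G}$ and $\mathcal U_0^{\mathcal K}$ are output and input spaces for $(\mathcal H,V,\mathfrak h)$. A closed subspace $\mathcal L\subset\mathcal H$ is a left support of $\gamma$ if $P_{\mathcal L}\gamma P_{\mathcal E^{\mathfrak k}_*}=\gamma P_{\mathcal E^{\mathfrak k}_*}$ and a right support of $\gamma$ if $\gamma P_{\mathcal E^{\mathfrak k}_*}=\gamma P_{\mathcal E^{\mathfrak k}_*}P_{\mathcal L}$. $\Gamma$-cascade: structure maps $(A,B,C,D)$ are the $\Gamma$-cascade of $(A^I,B^I,C^I,D^I)$ and $(A^{II},B^{II},C^{II},D^{II})$ if they are those of the combined system obtained by feeding $\Gamma$ applied to the output of system $I$ as input into system $II$, i.e. $A_j=\begin{pmatrix} A^I_j & 0 \\ B^{II}_j\Gamma C^I & A^{II}_j \end{pmatrix}$, $B_j=\begin{pmatrix} B^I_j \\ B^{II}_j\Gamma D^I \end{pmatrix}$, $C=(D^{II}\Gamma C^I\;\;C^{II})$, $D=D^{II}\Gamma D^I$. *)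

theory Defs
  imports "HOL-Analysis.Analysis"
begin

section \<open>Complex Hilbert spaces\<close>

text \<open>
  Complex scalars and a complex inner product (linear in the first argument) on top of the
  library's real Hilbert spaces, so that norm and topology are those of the library.
\<close>

class chilbert_space = real_inner + banach +
  fixes scaleC :: "complex \<Rightarrow> 'a \<Rightarrow> 'a"  (infixr \<open>*\<^sub>C\<close> 75)
    and cinner :: "'a \<Rightarrow> 'a \<Rightarrow> complex"
  assumes scaleC_add_right: "a *\<^sub>C (x + y) = a *\<^sub>C x + a *\<^sub>C y"
    and scaleC_add_left: "(a + b) *\<^sub>C x = a *\<^sub>C x + b *\<^sub>C x"
    and scaleC_scaleC: "a *\<^sub>C (b *\<^sub>C x) = (a * b) *\<^sub>C x"
    and scaleC_of_real: "complex_of_real r *\<^sub>C x = scaleR r x"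
    and cinner_commute: "cinner x y = cnj (cinner y x)"
    and cinner_add_left: "cinner (x + y) z = cinner x z + cinner y z"
    and cinner_scaleC_left: "cinner (a *\<^sub>C x) y = a * cinner x y"
    and Re_cinner: "Re (cinner x y) = inner x y"

lemma scaleC_one: "1 *\<^sub>C x = (x :: 'a::chilbert_space)"
  using scaleC_of_real[of 1 x] by simp

interpretation complex_vector: vector_space "scaleC :: complex \<Rightarrow> 'a \<Rightarrow> 'a::chilbert_space"
  by standard (simp_all add: scaleC_add_right scaleC_add_left scaleC_scaleC scaleC_one)

abbreviation csubspace :: "'a::chilbert_space set \<Rightarrow> bool"
  where "csubspace \<equiv> complex_vector.subspace"

abbreviation cspan :: "'a::chilbert_space set \<Rightarrow> 'a set"
  where "cspan \<equiv> complex_vector.span"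

lemma cinner_add_right: "cinner x (y + z) = cinner x y + cinner x (z :: 'a::chilbert_space)"
  by (subst (1 2 3) cinner_commute) (simp add: cinner_add_left)

lemma cinner_scaleC_right: "cinner x (a *\<^sub>C y) = cnj a * cinner x (y :: 'a::chilbert_space)"
  by (subst (1 2) cinner_commute) (simp add: cinner_scaleC_left)

lemma cinner_self: "cinner x x = complex_of_real ((norm (x :: 'a::chilbert_space))\<^sup>2)"
proof -
  have "Im (cinner x x) = - Im (cinner x x)"
    using arg_cong[OF cinner_commute[of x x], of Im] by simp
  then show ?thesis
    by (simp add: complex_eq_iff Re_cinner power2_norm_eq_inner)
qed

lemma Im_cinner: "Im (cinner x y) = - inner (\<i> *\<^sub>C x) (y :: 'a::chilbert_space)"
  using Re_cinner[of "\<i> *\<^sub>C x" y] by (simp add: cinner_scaleC_left)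

lemma norm_scaleC: "norm (a *\<^sub>C x) = cmod a * norm (x :: 'a::chilbert_space)"
proof -
  have "complex_of_real ((norm (a *\<^sub>C x))\<^sup>2) = a * cnj a * complex_of_real ((norm x)\<^sup>2)"
    by (simp only: cinner_self[symmetric] cinner_scaleC_left cinner_scaleC_right mult.assoc mult.left_commute)
  also have "\<dots> = complex_of_real ((cmod a * norm x)\<^sup>2)"
    by (simp only: complex_norm_square[symmetric] power_mult_distrib of_real_mult)
  finally have "(norm (a *\<^sub>C x))\<^sup>2 = (cmod a * norm x)\<^sup>2"
    using of_real_eq_iff by blast
  then show ?thesis
    by (simp add: power2_eq_iff_nonneg)
qed

instantiation prod :: (chilbert_space, chilbert_space) chilbert_space
begin

definition scaleC_prod_def: "a *\<^sub>C x = (a *\<^sub>C fst x, a *\<^sub>C snd x)"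

definition cinner_prod_def: "cinner x y = cinner (fst x) (fst y) + cinner (snd x) (snd y)"

instance
proof
  fix x y :: "'a \<times> 'b"
  show "cinner x y = cnj (cinner y x)"
    unfolding cinner_prod_def complex_cnj_add by (metis cinner_commute)
qed (auto simp: scaleC_prod_def cinner_prod_def scaleC_add_right scaleC_add_left scaleC_scaleC
      scaleC_of_real cinner_add_left cinner_scaleC_left Re_cinner inner_prod_def scaleR_prod_def
      algebra_simps)

end


section \<open>Hilbert space direct sums of copies of a space\<close>

typedef (overloaded) ('i, 'a) l2sum =
  "{f :: 'i \<Rightarrow> 'a::real_inner. (\<lambda>i. (norm (f i))\<^sup>2) summable_on UNIV}"
  morphisms coord Abs_l2sum
  by (rule exI[of _ "\<lambda>_. 0"]) simp

lemma coord_summable: "(\<lambda>i. (norm (coord f i))\<^sup>2) summable_on UNIV"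
  using coord[of f] by simp

lemma l2sum_eqI: "(\<And>i. coord f i = coord g i) \<Longrightarrow> f = g"
  by (simp add: coord_inject[symmetric] fun_eq_iff)

lemma coord_Abs_l2sum:
  "(\<lambda>i. (norm (f i))\<^sup>2) summable_on UNIV \<Longrightarrow> coord (Abs_l2sum f) i = f i"
  by (simp add: Abs_l2sum_inverse)

lemma l2_dominated:
  assumes "(\<lambda>i. (norm (f i))\<^sup>2) summable_on UNIV" "\<And>i. norm (g i) \<le> c * norm (f i)"
  shows "(\<lambda>i. (norm (g i))\<^sup>2) summable_on UNIV"
proof (rule summable_on_comparison_test)
  show "(\<lambda>i. c\<^sup>2 * (norm (f i))\<^sup>2) summable_on UNIV"
    by (intro summable_on_cmult_right assms)
  show "(norm (g i))\<^sup>2 \<le> c\<^sup>2 * (norm (f i))\<^sup>2" for i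
    using power_mono[OF assms(2)[of i], of 2] by (simp add: power_mult_distrib)
qed simp

lemma l2_add:
  assumes "(\<lambda>i. (norm (f i))\<^sup>2) summable_on UNIV" "(\<lambda>i. (norm (g i))\<^sup>2) summable_on UNIV"
  shows "(\<lambda>i. (norm (f i + g i))\<^sup>2) summable_on UNIV"
proof (rule summable_on_comparison_test)
  show "(\<lambda>i. 2 * (norm (f i))\<^sup>2 + 2 * (norm (g i))\<^sup>2) summable_on UNIV"
    by (intro summable_on_add summable_on_cmult_right assms)
  show "(norm (f i + g i))\<^sup>2 \<le> 2 * (norm (f i))\<^sup>2 + 2 * (norm (g i))\<^sup>2" for i
  proof -
    have "(norm (f i + g i))\<^sup>2 \<le> (norm (f i) + norm (g i))\<^sup>2"
      by (intro power_mono norm_triangle_ineq) simp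
    also have "\<dots> \<le> 2 * (norm (f i))\<^sup>2 + 2 * (norm (g i))\<^sup>2"
      using sum_squares_bound[of "norm (f i)" "norm (g i)"] by (simp add: power2_sum)
    finally show ?thesis .
  qed
qed simp

instantiation l2sum :: (type, real_inner) real_inner
begin

definition zero_l2sum_def: "(0 :: ('a, 'b) l2sum) = Abs_l2sum (\<lambda>_. 0)"
definition plus_l2sum_def: "(f :: ('a, 'b) l2sum) + g = Abs_l2sum (\<lambda>i. coord f i + coord g i)"
definition minus_l2sum_def: "(f :: ('a, 'b) l2sum) - g = Abs_l2sum (\<lambda>i. coord f i - coord g i)"
definition uminus_l2sum_def: "- (f :: ('a, 'b) l2sum) = Abs_l2sum (\<lambda>i. - coord f i)"
definition scaleR_l2sum_def: "r *\<^sub>R (f :: ('a, 'b) l2sum) = Abs_l2sum (\<lambda>i. r *\<^sub>R coord f i)"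
definition inner_l2sum_def: "inner (f :: ('a, 'b) l2sum) g = (\<Sum>\<^sub>\<infinity>i. inner (coord f i) (coord g i))"
definition norm_l2sum_def: "norm (f :: ('a, 'b) l2sum) = sqrt (inner f f)"
definition dist_l2sum_def: "dist (f :: ('a, 'b) l2sum) g = norm (f - g)"
definition sgn_l2sum_def: "sgn (f :: ('a, 'b) l2sum) = scaleR (inverse (norm f)) f"
definition uniformity_l2sum_def: "(uniformity :: (('a, 'b) l2sum \<times> ('a, 'b) l2sum) filter) =
  (INF e\<in>{0<..}. principal {(x, y). dist x y < e})"
definition open_l2sum_def: "open (U :: ('a, 'b) l2sum set) \<longleftrightarrow>
  (\<forall>x\<in>U. \<forall>\<^sub>F (x', y) in uniformity. x' = x \<longrightarrow> y \<in> U)"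

lemma coord_zero: "coord 0 i = 0"
  by (simp add: zero_l2sum_def coord_Abs_l2sum)

lemma coord_add: "coord (f + g) i = coord f i + coord g i"
  by (simp add: plus_l2sum_def coord_Abs_l2sum l2_add coord_summable)

lemma coord_scaleR: "coord (r *\<^sub>R f) i = r *\<^sub>R coord f i"
  unfolding scaleR_l2sum_def
  by (rule coord_Abs_l2sum, rule l2_dominated[OF coord_summable[of f], of _ "\<bar>r\<bar>"]) simp

lemma coord_uminus: "coord (- f) i = - coord f i"
  unfolding uminus_l2sum_def
  by (rule coord_Abs_l2sum, rule l2_dominated[OF coord_summable[of f], of _ 1]) simp

lemma coord_minus: "coord (f - g) i = coord f i - coord g i"
proof -
  have "(\<lambda>i. (norm (coord f i + coord (- g) i))\<^sup>2) summable_on UNIV"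
    by (intro l2_add coord_summable)
  then show ?thesis
    unfolding minus_l2sum_def by (subst coord_Abs_l2sum) (simp_all add: coord_uminus)
qed

lemma inner_coord_summable:
  "(\<lambda>i. inner (coord f i) (coord g i)) summable_on UNIV"
proof (rule abs_summable_summable, rule summable_on_comparison_test)
  show "(\<lambda>i. (norm (coord f i))\<^sup>2 + (norm (coord g i))\<^sup>2) summable_on UNIV"
    by (intro summable_on_add coord_summable)
  show "norm (inner (coord f i) (coord g i)) \<le> (norm (coord f i))\<^sup>2 + (norm (coord g i))\<^sup>2" for i
  proof -
    have "norm (inner (coord f i) (coord g i)) \<le> norm (coord f i) * norm (coord g i)"
      using Cauchy_Schwarz_ineq2 by simp
    also have "\<dots> \<le> (norm (coord f i))\<^sup>2 + (norm (coord g i))\<^sup>2"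
      using sum_squares_bound[of "norm (coord f i)" "norm (coord g i)"]
        mult_nonneg_nonneg[OF norm_ge_zero[of "coord f i"] norm_ge_zero[of "coord g i"]]
      by linarith
    finally show ?thesis .
  qed
qed simp

instance
proof
  fix f g h :: "('a, 'b) l2sum" and r s :: real
  show "f + g + h = f + (g + h)" "f + g = g + f" "0 + f = f" "- f + f = 0" "f - g = f + - g"
    "r *\<^sub>R (f + g) = r *\<^sub>R f + r *\<^sub>R g" "(r + s) *\<^sub>R f = r *\<^sub>R f + s *\<^sub>R f"
    "r *\<^sub>R s *\<^sub>R f = (r * s) *\<^sub>R f" "1 *\<^sub>R f = f"
    by (auto intro!: l2sum_eqI simp: coord_add coord_zero coord_uminus coord_minus coord_scaleR
        algebra_simps)
  show "dist f g = norm (f - g)" "sgn f = scaleR (inverse (norm f)) f" "norm f = sqrt (inner f f)"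
    by (fact dist_l2sum_def sgn_l2sum_def norm_l2sum_def)+
  show "inner f g = inner g f"
    by (simp add: inner_l2sum_def inner_commute)
  show "inner (f + g) h = inner f h + inner g h"
    by (simp add: inner_l2sum_def coord_add inner_add_left infsum_add inner_coord_summable)
  show "inner (r *\<^sub>R f) g = r * inner f g"
    by (simp add: inner_l2sum_def coord_scaleR infsum_cmult_right')
  show "0 \<le> inner f f"
    by (simp add: inner_l2sum_def infsum_nonneg)
  show "(inner f f = 0) = (f = 0)"
  proof
    assume "inner f f = 0"
    then have "inner (coord f i) (coord f i) = 0" for i
      using nonneg_infsum_le_0D[of "\<lambda>i. inner (coord f i) (coord f i)" UNIV i]
        inner_coord_summable[of f f]
      by (simp add: inner_l2sum_def)
    then show "f = 0"
      by (auto intro!: l2sum_eqI simp: coord_zero)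
  qed (simp add: inner_l2sum_def coord_zero)
qed (fact uniformity_l2sum_def open_l2sum_def)+

end

lemma norm_l2sum_sq: "(norm f)\<^sup>2 = (\<Sum>\<^sub>\<infinity>i. (norm (coord f i))\<^sup>2)"
  by (simp only: power2_norm_eq_inner inner_l2sum_def)

lemma sum_coord_le_norm: "finite F \<Longrightarrow> (\<Sum>i\<in>F. (norm (coord f i))\<^sup>2) \<le> (norm f)\<^sup>2"
  unfolding norm_l2sum_sq by (rule finite_sum_le_infsum) (auto simp: coord_summable)

lemma norm_coord_le: "norm (coord f i) \<le> norm f"
proof (rule power2_le_imp_le)
  show "(norm (coord f i))\<^sup>2 \<le> (norm f)\<^sup>2"
    using sum_coord_le_norm[of "{i}" f] by simp
qed simp

instance l2sum :: (type, "{real_inner, banach}") banach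
proof
  fix X :: "nat \<Rightarrow> ('a, 'b) l2sum"
  assume X: "Cauchy X"
  have "Cauchy (\<lambda>n. coord (X n) i)" for i
  proof (rule metric_CauchyI)
    fix e :: real assume "e > 0"
    then obtain M where "\<forall>m\<ge>M. \<forall>n\<ge>M. dist (X m) (X n) < e"
      using metric_CauchyD[OF X] by blast
    moreover have "dist (coord (X m) i) (coord (X n) i) \<le> dist (X m) (X n)" for m n
      using norm_coord_le[of "X m - X n" i] by (simp add: dist_norm coord_minus)
    ultimately show "\<exists>M. \<forall>m\<ge>M. \<forall>n\<ge>M. dist (coord (X m) i) (coord (X n) i) < e"
      by (meson le_less_trans)
  qed
  then have "\<forall>i. \<exists>l. (\<lambda>n. coord (X n) i) \<longlonglongrightarrow> l"
    using Cauchy_convergent by (auto simp: convergent_def)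
  then obtain L where L: "\<And>i. (\<lambda>n. coord (X n) i) \<longlonglongrightarrow> L i"
    by metis
  have fin: "(\<Sum>i\<in>F. (norm (coord (X m) i - L i))\<^sup>2) \<le> e\<^sup>2"
    if F: "finite F" and e: "0 \<le> e" "\<forall>n\<ge>M. dist (X m) (X n) \<le> e" for F m M e
  proof (rule LIMSEQ_le_const2)
    show "(\<lambda>n. \<Sum>i\<in>F. (norm (coord (X m) i - coord (X n) i))\<^sup>2)
        \<longlonglongrightarrow> (\<Sum>i\<in>F. (norm (coord (X m) i - L i))\<^sup>2)"
      by (intro tendsto_intros L)
    have "(\<Sum>i\<in>F. (norm (coord (X m) i - coord (X n) i))\<^sup>2) \<le> e\<^sup>2" if "n \<ge> M" for n
    proof -
      have "(\<Sum>i\<in>F. (norm (coord (X m - X n) i))\<^sup>2) \<le> (norm (X m - X n))\<^sup>2"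
        by (rule sum_coord_le_norm[OF F])
      also have "\<dots> \<le> e\<^sup>2"
        using e that by (intro power_mono) (auto simp: dist_norm)
      finally show ?thesis
        by (simp add: coord_minus)
    qed
    then show "\<exists>N. \<forall>n\<ge>N. (\<Sum>i\<in>F. (norm (coord (X m) i - coord (X n) i))\<^sup>2) \<le> e\<^sup>2"
      by blast
  qed
  have summ: "(\<lambda>i. (norm (coord (X m) i - L i))\<^sup>2) summable_on UNIV"
    if e: "0 \<le> e" "\<forall>n\<ge>M. dist (X m) (X n) \<le> e" for m M e
    by (rule nonneg_bdd_above_summable_on) (auto intro!: bdd_aboveI[of _ "e\<^sup>2"] fin[OF _ e])
  obtain M1 where M1: "\<forall>m\<ge>M1. \<forall>n\<ge>M1. dist (X m) (X n) < 1"
    using metric_CauchyD[OF X, of 1] by auto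
  have "(\<lambda>i. (norm (coord (X M1) i - L i))\<^sup>2) summable_on UNIV"
    by (rule summ[of 1 M1]) (use M1 in \<open>auto intro: less_imp_le\<close>)
  then have s1: "(\<lambda>i. (norm (L i - coord (X M1) i))\<^sup>2) summable_on UNIV"
    by (simp add: norm_minus_commute)
  have sL: "(\<lambda>i. (norm (L i))\<^sup>2) summable_on UNIV"
    using l2_add[OF s1 coord_summable[of "X M1"]] by simp
  have "X \<longlonglongrightarrow> Abs_l2sum L"
  proof (rule metric_LIMSEQ_I)
    fix r :: real assume r: "r > 0"
    then obtain M where M: "\<forall>m\<ge>M. \<forall>n\<ge>M. dist (X m) (X n) < r / 2"
      using metric_CauchyD[OF X, of "r / 2"] by auto
    have "dist (X m) (Abs_l2sum L) < r" if m: "m \<ge> M" for m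
    proof -
      have e: "0 \<le> r / 2" "\<forall>n\<ge>M. dist (X m) (X n) \<le> r / 2"
        using r M m by (auto intro: less_imp_le)
      have "(norm (X m - Abs_l2sum L))\<^sup>2 = (\<Sum>\<^sub>\<infinity>i. (norm (coord (X m) i - L i))\<^sup>2)"
        by (simp add: norm_l2sum_sq coord_minus coord_Abs_l2sum[OF sL])
      also have "\<dots> \<le> (r / 2)\<^sup>2"
        by (rule infsum_le_finite_sums[OF summ[OF e]]) (rule fin[OF _ e])
      finally have "norm (X m - Abs_l2sum L) \<le> r / 2"
        using e(1) by (rule power2_le_imp_le)
      then show ?thesis
        using r by (simp add: dist_norm)
    qed
    then show "\<exists>no. \<forall>n\<ge>no. dist (X n) (Abs_l2sum L) < r"
      by blast
  qed
  then show "convergent X"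
    by (auto simp: convergent_def)
qed

instantiation l2sum :: (type, chilbert_space) chilbert_space
begin

definition scaleC_l2sum_def: "a *\<^sub>C (f :: ('a, 'b) l2sum) = Abs_l2sum (\<lambda>i. a *\<^sub>C coord f i)"
definition cinner_l2sum_def: "cinner (f :: ('a, 'b) l2sum) g = (\<Sum>\<^sub>\<infinity>i. cinner (coord f i) (coord g i))"

lemma coord_scaleC: "coord (a *\<^sub>C f) i = a *\<^sub>C coord f i"
  unfolding scaleC_l2sum_def
  by (rule coord_Abs_l2sum, rule l2_dominated[OF coord_summable[of f], of _ "cmod a"])
    (simp add: norm_scaleC)

lemma cinner_coord_summable:
  fixes f g :: "('a, 'b) l2sum"
  shows "(\<lambda>i. cinner (coord f i) (coord g i)) summable_on UNIV"
proof -
  have "(\<lambda>i. complex_of_real (inner (coord f i) (coord g i))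
      + \<i> * complex_of_real (inner (coord (- (\<i> *\<^sub>C f)) i) (coord g i))) summable_on UNIV"
    by (intro summable_on_add summable_on_cmult_right summable_on_of_real
        inner_coord_summable)
  moreover have "complex_of_real (inner (coord f i) (coord g i))
      + \<i> * complex_of_real (inner (coord (- (\<i> *\<^sub>C f)) i) (coord g i))
      = cinner (coord f i) (coord g i)" for i
    by (simp add: complex_eq_iff Re_cinner Im_cinner coord_scaleC coord_uminus)
  ultimately show ?thesis
    by simp
qed

instance
proof
  fix f g h :: "('a, 'b) l2sum" and a b :: complex and r :: real
  show "a *\<^sub>C (f + g) = a *\<^sub>C f + a *\<^sub>C g" "(a + b) *\<^sub>C f = a *\<^sub>C f + b *\<^sub>C f"
    "a *\<^sub>C b *\<^sub>C f = (a * b) *\<^sub>C f" "complex_of_real r *\<^sub>C f = r *\<^sub>R f"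
    by (auto intro!: l2sum_eqI simp: coord_add coord_scaleC coord_scaleR scaleC_add_right
        scaleC_add_left scaleC_scaleC scaleC_of_real)
  show "cinner f g = cnj (cinner g f)"
    unfolding cinner_l2sum_def infsum_cnj[symmetric] by (subst cinner_commute) simp
  show "cinner (f + g) h = cinner f h + cinner g h"
    by (simp add: cinner_l2sum_def coord_add cinner_add_left infsum_add cinner_coord_summable)
  show "cinner (a *\<^sub>C f) g = a * cinner f g"
    by (simp add: cinner_l2sum_def coord_scaleC cinner_scaleC_left infsum_cmult_right')
  show "Re (cinner f g) = inner f g"
    unfolding cinner_l2sum_def inner_l2sum_def infsum_Re[OF cinner_coord_summable, symmetric]
    by (simp add: Re_cinner)
qed

end


text \<open>The vector \<open>x\<close> placed in the \<open>i\<close>-th copy.\<close>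

definition copy :: "'i \<Rightarrow> 'a::chilbert_space \<Rightarrow> ('i, 'a) l2sum"
  where "copy i x = Abs_l2sum (\<lambda>j. if j = i then x else 0)"

definition copies :: "'a::chilbert_space set \<Rightarrow> ('i, 'a) l2sum set"
  where "copies S = {f. \<forall>i. coord f i \<in> S}"

definition map_l2sum :: "('a::chilbert_space \<Rightarrow> 'b::chilbert_space) \<Rightarrow> ('i, 'a) l2sum \<Rightarrow> ('i, 'b) l2sum"
  where "map_l2sum \<phi> f = Abs_l2sum (\<lambda>i. \<phi> (coord f i))"

lemma coord_copy: "coord (copy i x) j = (if j = i then x else 0)"
proof -
  have "(\<lambda>j. (norm (if j = i then x else 0))\<^sup>2) summable_on {i}"
    by (rule summable_on_finite) simp
  then have "(\<lambda>j. (norm (if j = i then x else 0))\<^sup>2) summable_on UNIV"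
    by (rule summable_on_cong_neutral[THEN iffD1, rotated 3]) auto
  then show ?thesis
    unfolding copy_def by (rule coord_Abs_l2sum)
qed

lemma coord_map_l2sum:
  assumes "\<And>x. norm (\<phi> x) \<le> norm x"
  shows "coord (map_l2sum \<phi> f) i = \<phi> (coord f i)"
  unfolding map_l2sum_def
  by (rule coord_Abs_l2sum, rule l2_dominated[OF coord_summable[of f], of _ 1]) (simp add: assms)


section \<open>Operators on closed subspaces\<close>

text \<open>
  Hilbert spaces are closed subspaces of a type, and operators are functions on the type of which
  only the values on the relevant subspace matter.
\<close>

definition closed_csubspace :: "'a::chilbert_space set \<Rightarrow> bool"
  where "closed_csubspace L \<longleftrightarrow> csubspace L \<and> closed L"

definition cspan_closure :: "'a::chilbert_space set \<Rightarrow> 'a set"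
  where "cspan_closure S = closure (cspan S)"

definition clinear_on :: "'a::chilbert_space set \<Rightarrow> ('a \<Rightarrow> 'b::chilbert_space) \<Rightarrow> bool"
  where "clinear_on S T \<longleftrightarrow>
    (\<forall>x\<in>S. \<forall>y\<in>S. T (x + y) = T x + T y) \<and> (\<forall>a. \<forall>x\<in>S. T (a *\<^sub>C x) = a *\<^sub>C T x)"

definition ominus :: "'a::chilbert_space set \<Rightarrow> 'a set \<Rightarrow> 'a set"  (infixl \<open>\<ominus>\<close> 65)
  where "S \<ominus> T = {x \<in> S. \<forall>z\<in>T. cinner x z = 0}"

definition proj :: "'a::chilbert_space set \<Rightarrow> 'a \<Rightarrow> 'a"
  where "proj L x = (THE p. p \<in> L \<and> (\<forall>z\<in>L. cinner (x - p) z = 0))"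

text \<open>\<open>adj_on S T\<close> is the adjoint of \<open>T\<close> regarded as an operator with domain \<open>S\<close>.\<close>

definition adj_on ::
  "'a::chilbert_space set \<Rightarrow> ('a \<Rightarrow> 'b::chilbert_space) \<Rightarrow> 'b \<Rightarrow> 'a"
  where "adj_on S T y = (THE x. x \<in> S \<and> (\<forall>z\<in>S. cinner (T z) y = cinner z x))"

text \<open>The values on \<open>S\<close> of the positive square root of a positive operator on \<open>S\<close>.\<close>

definition sqrt_on :: "'a::chilbert_space set \<Rightarrow> ('a \<Rightarrow> 'a) \<Rightarrow> 'a \<Rightarrow> 'a"
  where "sqrt_on S T = (SOME R. clinear_on S R \<and> R ` S \<subseteq> S \<and>
    (\<forall>x\<in>S. cinner (R x) x \<in> \<real>\<^sub>\<ge>\<^sub>0) \<and> (\<forall>x\<in>S. R (R x) = T x))"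

definition contraction_on ::
  "'a::chilbert_space set \<Rightarrow> 'b::chilbert_space set \<Rightarrow> ('a \<Rightarrow> 'b) \<Rightarrow> bool"
  where "contraction_on S S' T \<longleftrightarrow>
    clinear_on S T \<and> T ` S \<subseteq> S' \<and> (\<forall>x\<in>S. norm (T x) \<le> norm x)"


section \<open>Processes\<close>

text \<open>
  The letters are the elements of a countable type \<open>'d\<close>, which indexes the orthonormal basis
  \<open>\<epsilon>\<close> of \<open>\<P>\<close>. The tensor product of \<open>S\<close> with \<open>\<P>\<close> is the direct sum of the
  subspaces \<open>S \<otimes> \<epsilon>\<^sub>k\<close>, that is \<open>copies S\<close>, with \<open>\<xi> \<otimes> \<epsilon>\<^sub>k = copy k \<xi>\<close>.
\<close>

definition row_isometry :: "'a::chilbert_space set \<Rightarrow> (('d, 'a) l2sum \<Rightarrow> 'a) \<Rightarrow> bool"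
  where "row_isometry H V \<longleftrightarrow>
    clinear_on (copies H) V \<and> V ` copies H \<subseteq> H \<and> (\<forall>f\<in>copies H. norm (V f) = norm f)"

definition letter_op :: "(('d, 'a::chilbert_space) l2sum \<Rightarrow> 'a) \<Rightarrow> 'd \<Rightarrow> 'a \<Rightarrow> 'a"
  where "letter_op V k \<xi> = V (copy k \<xi>)"

definition word_op :: "(('d, 'a::chilbert_space) l2sum \<Rightarrow> 'a) \<Rightarrow> 'd list \<Rightarrow> 'a \<Rightarrow> 'a"
  where "word_op V \<alpha> = foldr (letter_op V) \<alpha>"

definition coinvariant ::
  "'a::chilbert_space set \<Rightarrow> (('d, 'a) l2sum \<Rightarrow> 'a) \<Rightarrow> 'a set \<Rightarrow> bool"
  where "coinvariant H V h \<longleftrightarrow> (\<forall>k. adj_on H (letter_op V k) ` h \<subseteq> h)"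

fun is_process ::
  "'a::chilbert_space set \<times> (('d::countable, 'a) l2sum \<Rightarrow> 'a) \<times> 'a set \<Rightarrow> bool"
  where "is_process (H, V, h) \<longleftrightarrow>
    closed_csubspace H \<and> separable_space (top_of_set H) \<and> row_isometry H V \<and>
    closed_csubspace h \<and> h \<subseteq> H \<and> coinvariant H V h \<and>
    H = cspan_closure (\<Union>\<alpha>. word_op V \<alpha> ` h)"

text \<open>The spaces \<open>\<E>\<close> and \<open>\<E>\<^sub>*\<close>.\<close>

fun defect_space ::
  "'a::chilbert_space set \<times> (('d, 'a) l2sum \<Rightarrow> 'a) \<times> 'a set \<Rightarrow> 'a set"
  where "defect_space (H, V, h) = cspan_closure (h \<union> V ` copies h) \<ominus> h"

fun defect_space_star ::
  "'a::chilbert_space set \<times> (('d, 'a) l2sum \<Rightarrow> 'a) \<times> 'a set \<Rightarrow> 'a set"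
  where "defect_space_star (H, V, h) = cspan_closure (h \<union> V ` copies h) \<ominus> V ` copies h"

fun input_space ::
  "'a::chilbert_space set \<times> (('d, 'a) l2sum \<Rightarrow> 'a) \<times> 'a set \<Rightarrow> 'a set \<Rightarrow> bool"
  where "input_space (H, V, h) U \<longleftrightarrow> closed_csubspace U \<and> U \<subseteq> defect_space (H, V, h)"

fun output_space ::
  "'a::chilbert_space set \<times> (('d, 'a) l2sum \<Rightarrow> 'a) \<times> 'a set \<Rightarrow> 'a set \<Rightarrow> bool"
  where "output_space (H, V, h) Y \<longleftrightarrow>
    closed_csubspace Y \<and> Y \<subseteq> {x + e | x e. x \<in> h \<and> e \<in> defect_space (H, V, h)}"

fun structure_maps ::
  "'a::chilbert_space set \<times> (('d, 'a) l2sum \<Rightarrow> 'a) \<times> 'a set \<Rightarrow> 'a set \<Rightarrow> 'a set \<Rightarrow>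
    ('d \<Rightarrow> 'a \<Rightarrow> 'a) \<times> ('d \<Rightarrow> 'a \<Rightarrow> 'a) \<times> ('a \<Rightarrow> 'a) \<times> ('a \<Rightarrow> 'a)"
  where "structure_maps (H, V, h) U Y =
    (\<lambda>j. restrict (adj_on H (letter_op V j)) h,
     \<lambda>j. restrict (adj_on H (letter_op V j)) U,
     restrict (proj Y) h,
     restrict (proj Y) U)"


section \<open>The extension of a process by a contraction\<close>

text \<open>
  The extension lives on the type \<open>'g \<times> 'k \<times> ('d list, 'g) l2sum\<close>, whose components
  hold the summands \<open>\<gg>\<close>, \<open>\<K>\<close> and the copies of the defect space of \<open>\<gamma>\<^sup>*\<close>.
\<close>

text \<open>The operator \<open>D\<close> with index \<open>\<gamma>\<^sup>*\<close>, i.e. the square root of \<open>1 - \<gamma>\<gamma>\<^sup>*\<close>.\<close>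

definition defect_op ::
  "'g::chilbert_space set \<times> (('d, 'g) l2sum \<Rightarrow> 'g) \<times> 'g set \<Rightarrow> ('k \<Rightarrow> 'g) \<Rightarrow>
    'k::chilbert_space set \<times> (('d, 'k) l2sum \<Rightarrow> 'k) \<times> 'k set \<Rightarrow> 'g \<Rightarrow> 'g"
  where "defect_op PG \<gamma> PK =
    sqrt_on (defect_space PG) (\<lambda>e. e - \<gamma> (adj_on (defect_space_star PK) \<gamma> e))"

text \<open>
  The operator \<open>1 \<oplus> (\<gamma>\<^sup>*, D)\<close> on \<open>\<gg> \<oplus> \<E>\<close>, where \<open>\<E>\<close> is the defect space of the
  first process. It is also the identification of \<open>\<gg> \<oplus> \<E>\<close> with a subspace of the extension.
\<close>

fun embed_G ::
  "'g::chilbert_space set \<times> (('d, 'g) l2sum \<Rightarrow> 'g) \<times> 'g set \<Rightarrow> ('k \<Rightarrow> 'g) \<Rightarrow>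
    'k::chilbert_space set \<times> (('d, 'k) l2sum \<Rightarrow> 'k) \<times> 'k set \<Rightarrow>
    'g \<Rightarrow> 'g \<times> 'k \<times> ('d list, 'g) l2sum"
  where "embed_G (G, VG, g) \<gamma> PK v =
    (let e = proj (defect_space (G, VG, g)) v
     in (proj g v, adj_on (defect_space_star PK) \<gamma> e,
         copy [] (defect_op (G, VG, g) \<gamma> PK e)))"

definition embed_K :: "'k::chilbert_space \<Rightarrow> 'g::chilbert_space \<times> 'k \<times> ('d list, 'g) l2sum"
  where "embed_K y = (0, y, 0)"

definition row_shift :: "('d, ('d list, 'g::chilbert_space) l2sum) l2sum \<Rightarrow> ('d list, 'g) l2sum"
  where "row_shift f = Abs_l2sum (\<lambda>\<alpha>. case \<alpha> of [] \<Rightarrow> 0 | k # \<beta> \<Rightarrow> coord (coord f k) \<beta>)"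

lemma coord_row_shift:
  "coord (row_shift f) \<alpha> = (case \<alpha> of [] \<Rightarrow> 0 | k # \<beta> \<Rightarrow> coord (coord f k) \<beta>)"
proof -
  let ?s = "\<lambda>\<alpha>. (norm (case \<alpha> of [] \<Rightarrow> 0 | k # \<beta> \<Rightarrow> coord (coord f k) \<beta>))\<^sup>2"
  have "(\<lambda>(k, \<beta>). (norm (coord (coord f k) \<beta>))\<^sup>2) summable_on (SIGMA k:UNIV. UNIV)"
  proof (rule summable_on_SigmaI)
    show "((\<lambda>\<beta>. case (k, \<beta>) of (k, \<beta>) \<Rightarrow> (norm (coord (coord f k) \<beta>))\<^sup>2)
        has_sum (norm (coord f k))\<^sup>2) UNIV" for k
      by (simp add: norm_l2sum_sq coord_summable)
    show "(\<lambda>k. (norm (coord f k))\<^sup>2) summable_on UNIV"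
      by (rule coord_summable)
  qed auto
  then have "(?s \<circ> (\<lambda>(k, \<beta>). k # \<beta>)) summable_on UNIV"
    by (simp add: o_def case_prod_unfold)
  then have "?s summable_on range (\<lambda>(k, \<beta>). k # \<beta>)"
    by (subst summable_on_reindex) (auto simp: inj_def)
  then have "?s summable_on UNIV"
    by (rule summable_on_cong_neutral[THEN iffD1, rotated 3])
      (auto split: list.splits simp: image_iff)
  then show ?thesis
    unfolding row_shift_def by (rule coord_Abs_l2sum)
qed

fun gamma_extension ::
  "'g::chilbert_space set \<times> (('d, 'g) l2sum \<Rightarrow> 'g) \<times> 'g set \<Rightarrow> ('k \<Rightarrow> 'g) \<Rightarrow>
    'k::chilbert_space set \<times> (('d, 'k) l2sum \<Rightarrow> 'k) \<times> 'k set \<Rightarrow>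
    ('g \<times> 'k \<times> ('d list, 'g) l2sum) set \<times>
    (('d, 'g \<times> 'k \<times> ('d list, 'g) l2sum) l2sum \<Rightarrow> 'g \<times> 'k \<times> ('d list, 'g) l2sum) \<times>
    ('g \<times> 'k \<times> ('d list, 'g) l2sum) set"
  where "gamma_extension (G, VG, g) \<gamma> (K, VK, k) =
    (g \<times> K \<times> copies (closure (defect_op (G, VG, g) \<gamma> (K, VK, k) ` defect_space (G, VG, g))),
     \<lambda>f. embed_G (G, VG, g) \<gamma> (K, VK, k) (VG (map_l2sum fst f))
          + (0, VK (map_l2sum (\<lambda>v. fst (snd v)) f), row_shift (map_l2sum (\<lambda>v. snd (snd v)) f)),
     g \<times> k \<times> {0})"

text \<open>\<open>\<gamma>\<close> as an operator inside the extension, defined on the copy of its domain in \<open>\<K>\<close>.\<close>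

definition embedded_gamma ::
  "'g::chilbert_space set \<times> (('d, 'g) l2sum \<Rightarrow> 'g) \<times> 'g set \<Rightarrow> ('k \<Rightarrow> 'g) \<Rightarrow>
    'k::chilbert_space set \<times> (('d, 'k) l2sum \<Rightarrow> 'k) \<times> 'k set \<Rightarrow>
    'g \<times> 'k \<times> ('d list, 'g) l2sum \<Rightarrow> 'g \<times> 'k \<times> ('d list, 'g) l2sum"
  where "embedded_gamma PG \<gamma> PK = (\<lambda>(x, y, s). embed_G PG \<gamma> PK (\<gamma> y))"

text \<open>
  Supports, in the Hilbert space \<open>H\<close>, of an operator \<open>T\<close> defined on the subspace \<open>S\<close> of \<open>H\<close>.
\<close>

definition left_support ::
  "'a::chilbert_space set \<Rightarrow> 'a set \<Rightarrow> ('a \<Rightarrow> 'a) \<Rightarrow> 'a set \<Rightarrow> bool"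
  where "left_support H S T L \<longleftrightarrow> closed_csubspace L \<and> L \<subseteq> H \<and>
    (\<forall>\<xi>\<in>H. proj L (T (proj S \<xi>)) = T (proj S \<xi>))"

definition right_support ::
  "'a::chilbert_space set \<Rightarrow> 'a set \<Rightarrow> ('a \<Rightarrow> 'a) \<Rightarrow> 'a set \<Rightarrow> bool"
  where "right_support H S T L \<longleftrightarrow> closed_csubspace L \<and> L \<subseteq> H \<and>
    (\<forall>\<xi>\<in>H. T (proj S \<xi>) = T (proj S (proj L \<xi>)))"


section \<open>Cascades\<close>

text \<open>The state space of the cascade is the product of those of the two systems.\<close>

fun cascade ::
  "('y1 \<Rightarrow> 'u2) \<Rightarrow>
    ('d \<Rightarrow> 'x1 \<Rightarrow> 'x1) \<times> ('d \<Rightarrow> 'u1 \<Rightarrow> 'x1) \<times> ('x1 \<Rightarrow> 'y1) \<times> ('u1 \<Rightarrow> 'y1) \<Rightarrow>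
    ('d \<Rightarrow> 'x2 \<Rightarrow> 'x2) \<times> ('d \<Rightarrow> 'u2 \<Rightarrow> 'x2) \<times> ('x2 \<Rightarrow> 'y2) \<times> ('u2 \<Rightarrow> 'y2) \<Rightarrow>
    ('d \<Rightarrow> 'x1 \<times> 'x2 \<Rightarrow> 'x1 \<times> 'x2::plus) \<times> ('d \<Rightarrow> 'u1 \<Rightarrow> 'x1 \<times> 'x2) \<times>
    ('x1 \<times> 'x2 \<Rightarrow> 'y2::plus) \<times> ('u1 \<Rightarrow> 'y2)"
  where "cascade \<Gamma> (A1, B1, C1, D1) (A2, B2, C2, D2) =
    (\<lambda>j (x, z). (A1 j x, B2 j (\<Gamma> (C1 x)) + A2 j z),
     \<lambda>j u. (B1 j u, B2 j (\<Gamma> (D1 u))),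
     \<lambda>(x, z). D2 (\<Gamma> (C1 x)) + C2 z,
     \<lambda>u. D2 (\<Gamma> (D1 u)))"

text \<open>
  Equality of structure maps with state space \<open>X\<close> and input space \<open>U\<close> for the second system,
  after identification of its state, input and output vectors with those of the first system
  by means of \<open>\<iota>X\<close>, \<open>\<iota>U\<close> and \<open>\<iota>Y\<close>.
\<close>

fun same_structure_maps ::
  "('x' \<Rightarrow> 'x) \<Rightarrow> ('u' \<Rightarrow> 'u) \<Rightarrow> ('y' \<Rightarrow> 'y) \<Rightarrow> 'x' set \<Rightarrow> 'u' set \<Rightarrow>
    ('d \<Rightarrow> 'x \<Rightarrow> 'x) \<times> ('d \<Rightarrow> 'u \<Rightarrow> 'x) \<times> ('x \<Rightarrow> 'y) \<times> ('u \<Rightarrow> 'y) \<Rightarrow>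
    ('d \<Rightarrow> 'x' \<Rightarrow> 'x') \<times> ('d \<Rightarrow> 'u' \<Rightarrow> 'x') \<times> ('x' \<Rightarrow> 'y') \<times> ('u' \<Rightarrow> 'y') \<Rightarrow> bool"
  where "same_structure_maps \<iota>X \<iota>U \<iota>Y X U (A, B, C, D) (A', B', C', D') \<longleftrightarrow>
    (\<forall>j. \<forall>x\<in>X. A j (\<iota>X x) = \<iota>X (A' j x)) \<and>
    (\<forall>j. \<forall>u\<in>U. B j (\<iota>U u) = \<iota>X (B' j u)) \<and>
    (\<forall>x\<in>X. C (\<iota>X x) = \<iota>Y (C' x)) \<and>
    (\<forall>u\<in>U. D (\<iota>U u) = \<iota>Y (D' u))"

end

theory Submission
  imports Defs
begin

text \<open>
  Everything reduces to the operator \<open>\<gamma> P\<close>, where \<open>P\<close> is the projection of \<open>\<K>\<close> onto the domain of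
  \<open>\<gamma>\<close>. Since \<open>1 - \<gamma>\<gamma>\<^sup>*\<close> has a positive square root, \<open>\<iota>\<close> is isometric on \<open>\<gg> \<oplus> \<E>\<close>, and
  \<open>\<langle>(x, y, 0), \<iota> w\<rangle> = \<langle>x + \<gamma> P y, w\<rangle>\<close> there. Hence projecting \<open>(x, y, 0)\<close> onto an embedded
  output space amounts to doing so with \<open>x + \<gamma> P y\<close> in \<open>\<G>\<close>, and the \<open>\<gg>\<close>-component of the adjoint
  of \<open>V\<^sub>j\<close> at \<open>(x, y, 0)\<close> is that of \<open>\<G>\<close> at \<open>x + \<gamma> P y\<close>. The right support condition gives
  \<open>\<gamma> P y = \<gamma> P y'\<close> for the output \<open>y'\<close> of \<open>\<K>\<close>, and the left support condition puts this vector
  into the input space of \<open>\<G>\<close>, so that it equals \<open>\<Gamma> y'\<close>.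
\<close>

section \<open>Inner products and projections\<close>

lemma cinner_diff_left: "cinner (x - y) z = cinner x z - cinner y (z :: 'a::chilbert_space)"
  using cinner_add_left[of "x - y" y z] by (simp add: algebra_simps)

lemma cinner_diff_right: "cinner z (x - y) = cinner z x - cinner z (y :: 'a::chilbert_space)"
  using cinner_add_right[of z "x - y" y] by (simp add: algebra_simps)

lemma cinner_zero_left [simp]: "cinner 0 (z :: 'a::chilbert_space) = 0"
  using cinner_diff_left[of 0 0 z] by simp

lemma cinner_zero_right [simp]: "cinner z (0 :: 'a::chilbert_space) = 0"
  using cinner_diff_right[of z 0 0] by simp

lemma cinner_eq_zero_iff [simp]: "cinner x x = 0 \<longleftrightarrow> (x :: 'a::chilbert_space) = 0"
  by (simp add: cinner_self)

lemma cinner_eq_zero_commute: "cinner x y = 0 \<longleftrightarrow> cinner y (x :: 'a::chilbert_space) = 0"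
  by (subst cinner_commute) simp

lemma bounded_linear_scaleC: "bounded_linear (scaleC a :: 'a::chilbert_space \<Rightarrow> 'a)"
proof (rule bounded_linear_intro[where K = "cmod a"])
  show "a *\<^sub>C (r *\<^sub>R x) = r *\<^sub>R (a *\<^sub>C x)" for r and x :: 'a
    by (simp add: scaleC_of_real[symmetric] scaleC_scaleC mult.commute)
qed (simp_all add: scaleC_add_right norm_scaleC mult.commute)

text \<open>Real and imaginary part are real inner products, which are bounded. The lemma carries
  limits and infinite sums through \<open>cinner\<close>.\<close>

lemma bounded_linear_cinner_left: "bounded_linear (\<lambda>x :: 'a::chilbert_space. cinner x y)"
proof -
  have "cinner x y = complex_of_real (inner x y) + \<i> * complex_of_real (- inner (\<i> *\<^sub>C x) y)"
    for x :: 'a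
    by (simp add: complex_eq_iff Re_cinner Im_cinner)
  moreover have "bounded_linear (\<lambda>x :: 'a. complex_of_real (inner x y)
      + \<i> * complex_of_real (- inner (\<i> *\<^sub>C x) y))"
    by (intro bounded_linear_add bounded_linear_const_mult
        bounded_linear_compose[OF bounded_linear_of_real] bounded_linear_minus
        bounded_linear_inner_left
        bounded_linear_compose[OF bounded_linear_inner_left bounded_linear_scaleC])
  ultimately show ?thesis
    by simp
qed

lemma csubspace_scaleR:
  assumes "csubspace S" "x \<in> S"
  shows "r *\<^sub>R x \<in> S"
  using complex_vector.subspace_scale[OF assms] by (metis scaleC_of_real)

text \<open>Testing with \<open>p - q\<close> itself gives the uniqueness behind the
  \<open>THE\<close> in \<open>proj\<close> and \<open>adj_on\<close>.\<close>

lemma csubspace_orthogonal_unique: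
  assumes S: "csubspace S" and "p \<in> S" "q \<in> S" and eq: "\<And>z. z \<in> S \<Longrightarrow> cinner z p = cinner z q"
  shows "p = q"
proof -
  have "cinner (p - q) (p - q) = 0"
    using eq[of "p - q"] assms by (simp add: cinner_diff_right complex_vector.subspace_diff)
  then show ?thesis
    by simp
qed

text \<open>Only a subspace is asked for, existence coming from the witness \<open>p\<close>; so
  images under \<open>\<iota>\<close> and \<open>embed_K\<close> are covered without proving them
  closed.\<close>

lemma proj_eqI:
  assumes S: "csubspace S" and p: "p \<in> S" "\<And>z. z \<in> S \<Longrightarrow> cinner x z = cinner p z"
  shows "proj S x = p"
  unfolding proj_def
proof (rule the_equality)
  show "p \<in> S \<and> (\<forall>z\<in>S. cinner (x - p) z = 0)"
    using p by (simp add: cinner_diff_left)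
  fix q assume q: "q \<in> S \<and> (\<forall>z\<in>S. cinner (x - q) z = 0)"
  show "q = p"
  proof (rule csubspace_orthogonal_unique[OF S])
    show "cinner z q = cinner z p" if "z \<in> S" for z
      using q p(2)[OF that] that by (subst (1 2) cinner_commute) (simp add: cinner_diff_left)
  qed (use p q in auto)
qed

lemma adj_on_eqI:
  assumes S: "csubspace S" and p: "p \<in> S" "\<And>z. z \<in> S \<Longrightarrow> cinner (T z) y = cinner z p"
  shows "adj_on S T y = p"
  unfolding adj_on_def
proof (rule the_equality)
  show "p \<in> S \<and> (\<forall>z\<in>S. cinner (T z) y = cinner z p)"
    using p by simp
  fix q assume "q \<in> S \<and> (\<forall>z\<in>S. cinner (T z) y = cinner z q)"
  then show "q = p"
    using p by (intro csubspace_orthogonal_unique[OF S]) auto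
qed

text \<open>A minimising sequence for the distance is Cauchy by the parallelogram law, and
  completeness supplies its limit.\<close>

lemma closest_point_exists:
  fixes S :: "'a::chilbert_space set"
  assumes S: "closed_csubspace S"
  obtains p where "p \<in> S" "\<And>z. z \<in> S \<Longrightarrow> norm (x - p) \<le> norm (x - z)"
proof -
  have sub: "csubspace S" and cl: "closed S"
    using S by (auto simp: closed_csubspace_def)
  define D where "D = (\<lambda>z. (norm (x - z))\<^sup>2) ` S"
  have ne: "D \<noteq> {}" and bdd: "bdd_below D"
    using complex_vector.subspace_0[OF sub] by (auto simp: D_def intro!: bdd_belowI[of _ 0])
  have low: "Inf D \<le> (norm (x - z))\<^sup>2" if "z \<in> S" for z
    using that bdd by (auto simp: D_def intro!: cInf_lower)
  have "\<exists>z\<in>S. (norm (x - z))\<^sup>2 < Inf D + inverse (real (Suc n))" for n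
    using cInf_lessD[OF ne, of "Inf D + inverse (real (Suc n))"] by (auto simp: D_def)
  then obtain z where z: "\<And>n. z n \<in> S" "\<And>n. (norm (x - z n))\<^sup>2 < Inf D + inverse (real (Suc n))"
    by metis
  \<comment> \<open>The midpoint lies in \<open>S\<close>, so its squared distance to
    \<open>x\<close> is at least \<open>Inf D\<close>; the parallelogram identity turns this into a
    bound on \<open>z m - z n\<close>.\<close>
  have par: "(norm (z m - z n))\<^sup>2 \<le> 2 * inverse (real (Suc m)) + 2 * inverse (real (Suc n))" for m n
  proof -
    have "(1/2) *\<^sub>R (z m + z n) \<in> S"
      by (intro csubspace_scaleR[OF sub] complex_vector.subspace_add[OF sub] z)
    then have "Inf D \<le> (norm (x - (1/2) *\<^sub>R (z m + z n)))\<^sup>2"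
      by (rule low)
    moreover have "(norm (z m - z n))\<^sup>2 = 2 * (norm (x - z m))\<^sup>2 + 2 * (norm (x - z n))\<^sup>2
        - 4 * (norm (x - (1/2) *\<^sub>R (z m + z n)))\<^sup>2"
      by (simp add: power2_norm_eq_inner inner_add_left inner_add_right inner_diff_left
          inner_diff_right inner_commute algebra_simps)
    ultimately show ?thesis
      using z(2)[of m] z(2)[of n] by linarith
  qed
  have "Cauchy z"
  proof (rule metric_CauchyI)
    fix e :: real assume e: "e > 0"
    then obtain N where N: "inverse (real (Suc N)) < e\<^sup>2 / 4"
      using reals_Archimedean[of "e\<^sup>2 / 4"] by auto
    have "dist (z m) (z n) < e" if "m \<ge> N" "n \<ge> N" for m n
    proof -
      have "inverse (real (Suc m)) \<le> inverse (real (Suc N))" "inverse (real (Suc n)) \<le> inverse (real (Suc N))"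
        using that by (auto intro!: le_imp_inverse_le)
      then have "(norm (z m - z n))\<^sup>2 < e\<^sup>2"
        using par[of m n] N by linarith
      then show ?thesis
        using e by (simp add: dist_norm power_less_imp_less_base)
    qed
    then show "\<exists>M. \<forall>m\<ge>M. \<forall>n\<ge>M. dist (z m) (z n) < e"
      by blast
  qed
  then obtain p where p: "z \<longlonglongrightarrow> p"
    using Cauchy_convergent by (auto simp: convergent_def)
  show ?thesis
  proof
    show "p \<in> S"
      using closed_sequentially[OF cl z(1) p] .
    fix w assume w: "w \<in> S"
    have "(\<lambda>n. (norm (x - z n))\<^sup>2) \<longlonglongrightarrow> (norm (x - p))\<^sup>2"
      by (intro tendsto_intros p)
    moreover have "(\<lambda>n. Inf D + inverse (real (Suc n))) \<longlonglongrightarrow> Inf D + 0"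
      by (intro tendsto_intros LIMSEQ_inverse_real_of_nat)
    ultimately have "(norm (x - p))\<^sup>2 \<le> Inf D + 0"
      by (rule LIMSEQ_le) (use z(2) less_imp_le in blast)
    also have "\<dots> \<le> (norm (x - w))\<^sup>2"
      using low[OF w] by simp
    finally show "norm (x - p) \<le> norm (x - w)"
      by (rule power2_le_imp_le) simp
  qed
qed

lemma inner_eq_zero_if_closest:
  fixes v z :: "'a::real_inner"
  assumes "\<And>t. norm v \<le> norm (v - t *\<^sub>R z)"
  shows "inner v z = 0"
proof (cases "z = 0")
  case False
  \<comment> \<open>The minimiser of the quadratic \<open>(norm (v - t *\<^sub>R z))\<^sup>2\<close>
    in \<open>t\<close>.\<close>
  define t where "t = inner v z / inner z z"
  have "(norm v)\<^sup>2 \<le> (norm (v - t *\<^sub>R z))\<^sup>2"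
    by (intro power_mono assms) simp
  also have "\<dots> = (norm v)\<^sup>2 - 2 * t * inner v z + t * (t * inner z z)"
    by (simp add: power2_norm_eq_inner inner_diff_left inner_diff_right inner_commute)
  also have "\<dots> = (norm v)\<^sup>2 - (inner v z)\<^sup>2 / inner z z"
    using False by (simp add: t_def power2_eq_square)
  finally have "(inner v z)\<^sup>2 / inner z z \<le> 0"
    by simp
  moreover have "inner z z > 0"
    using False by simp
  ultimately show ?thesis
    by (simp add: divide_le_0_iff)
qed simp

text \<open>The closest point is the projection: moving it within \<open>S\<close> by real multiples
  shows that the real inner product vanishes, and the complex one follows.\<close>

lemma proj_closed_csubspace:
  assumes S: "closed_csubspace S"
  shows proj_in: "proj S x \<in> S"
    and cinner_proj: "z \<in> S \<Longrightarrow> cinner (proj S x) z = cinner x z"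
proof -
  have sub: "csubspace S"
    using S by (auto simp: closed_csubspace_def)
  obtain p where p: "p \<in> S" "\<And>z. z \<in> S \<Longrightarrow> norm (x - p) \<le> norm (x - z)"
    using closest_point_exists[OF S] by blast
  have re: "inner (x - p) z = 0" if "z \<in> S" for z
  proof (rule inner_eq_zero_if_closest)
    show "norm (x - p) \<le> norm (x - p - t *\<^sub>R z)" for t
      using p(2)[of "p + t *\<^sub>R z"] that sub p(1)
      by (simp add: complex_vector.subspace_add csubspace_scaleR diff_diff_eq)
  qed
  have orth: "cinner (x - p) z = 0" if "z \<in> S" for z
  proof -
    \<comment> \<open>The real part of the pairing with \<open>\<i> *\<^sub>C z\<close> is the
      imaginary part of the pairing with \<open>z\<close>.\<close>
    have "Re (cinner (x - p) (\<i> *\<^sub>C z)) = 0"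
      using re[of "\<i> *\<^sub>C z"] that sub by (simp add: Re_cinner complex_vector.subspace_scale)
    then show ?thesis
      using re[OF that] by (simp add: complex_eq_iff Re_cinner cinner_scaleC_right)
  qed
  then have "proj S x = p"
    by (intro proj_eqI sub p(1)) (simp add: cinner_diff_left)
  then show "proj S x \<in> S" "z \<in> S \<Longrightarrow> cinner (proj S x) z = cinner x z"
    using p orth by (auto simp: cinner_diff_left)
qed

lemma cinner_proj_right:
  assumes "closed_csubspace S" "z \<in> S"
  shows "cinner z (proj S x) = cinner z x"
  by (subst (1 2) cinner_commute) (simp add: cinner_proj[OF assms])

lemma proj_clinear:
  assumes S: "closed_csubspace S"
  shows "proj S (x + y) = proj S x + proj S y" "proj S (a *\<^sub>C x) = a *\<^sub>C proj S x"
proof -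
  have sub: "csubspace S"
    using S by (simp add: closed_csubspace_def)
  show "proj S (x + y) = proj S x + proj S y"
    by (intro proj_eqI sub complex_vector.subspace_add proj_in S)
      (simp add: cinner_add_left cinner_proj[OF S])
  show "proj S (a *\<^sub>C x) = a *\<^sub>C proj S x"
    by (intro proj_eqI sub complex_vector.subspace_scale proj_in S)
      (simp add: cinner_scaleC_left cinner_proj[OF S])
qed

lemma norm_le_if_cinner_eq:
  assumes "cinner p p = cinner x (p :: 'a::chilbert_space)"
  shows "norm p \<le> norm x"
proof -
  have "(norm p)\<^sup>2 = inner x p"
    using assms by (metis Re_cinner power2_norm_eq_inner)
  also have "\<dots> \<le> norm x * norm p"
    by (rule norm_cauchy_schwarz)
  finally show ?thesis
    by (cases "norm p = 0") (auto simp: power2_eq_square)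
qed

lemma norm_proj_le: "closed_csubspace S \<Longrightarrow> norm (proj S x) \<le> norm x"
  by (intro norm_le_if_cinner_eq cinner_proj proj_in)

lemma proj_self: "closed_csubspace S \<Longrightarrow> x \<in> S \<Longrightarrow> proj S x = x"
  by (intro proj_eqI) (auto simp: closed_csubspace_def)

section \<open>Adjoints of contractions on closed subspaces\<close>

lemma clinear_on_minus:
  assumes "clinear_on S T" "csubspace S" "x \<in> S" "y \<in> S"
  shows "T (x - y) = T x - T y"
proof -
  have "T (x - y + y) = T (x - y) + T y"
    using assms complex_vector.subspace_diff unfolding clinear_on_def by blast
  then show ?thesis
    by simp
qed

text \<open>The Riesz representation of the functional \<open>cinner (T z) y\<close> on
  \<open>S\<close>, proved by splitting off its kernel \<open>N\<close>. \<open>T\<close> is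
  controlled on \<open>S\<close> only, so closedness of \<open>N\<close> is derived there from the
  norm bound.\<close>

lemma adj_on_contraction:
  assumes S: "closed_csubspace S" and T: "clinear_on S T" "\<And>x. x \<in> S \<Longrightarrow> norm (T x) \<le> norm x"
  shows adj_on_in: "adj_on S T y \<in> S"
    and cinner_adj_on: "z \<in> S \<Longrightarrow> cinner (T z) y = cinner z (adj_on S T y)"
proof -
  have sub: "csubspace S" and cl: "closed S"
    using S by (auto simp: closed_csubspace_def)
  have add: "T (x + z) = T x + T z" if "x \<in> S" "z \<in> S" for x z
    using T(1) that by (auto simp: clinear_on_def)
  have scale: "T (a *\<^sub>C x) = a *\<^sub>C T x" if "x \<in> S" for a x
    using T(1) that by (auto simp: clinear_on_def)
  note diff = clinear_on_minus[OF T(1) sub]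
  define N where "N = {z \<in> S. cinner (T z) y = 0}"
  have "closed N"
  proof (rule closed_sequential_limits[THEN iffD2], intro allI impI, elim conjE)
    fix u l assume u: "\<forall>n. u n \<in> N" "u \<longlonglongrightarrow> l"
    then have l: "l \<in> S"
      using closed_sequentially[OF cl, of u l] by (auto simp: N_def)
    have "(\<lambda>n. T (u n)) \<longlonglongrightarrow> T l"
    proof (rule metric_LIMSEQ_I)
      fix r :: real assume "r > 0"
      then obtain n0 where "\<forall>n\<ge>n0. dist (u n) l < r"
        using metric_LIMSEQ_D[OF u(2)] by blast
      moreover have "dist (T (u n)) (T l) \<le> dist (u n) l" for n
        using T(2)[of "u n - l"] u(1) l
        by (simp add: dist_norm N_def diff complex_vector.subspace_diff[OF sub])
      ultimately show "\<exists>n0. \<forall>n\<ge>n0. dist (T (u n)) (T l) < r"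
        by (meson le_less_trans)
    qed
    then have "(\<lambda>n. cinner (T (u n)) y) \<longlonglongrightarrow> cinner (T l) y"
      by (rule bounded_linear.tendsto[OF bounded_linear_cinner_left])
    then have "cinner (T l) y = 0"
      using u(1) by (simp add: N_def LIMSEQ_const_iff)
    then show "l \<in> N"
      using l by (simp add: N_def)
  qed
  moreover have "csubspace N"
    using sub scale[of 0 0] unfolding complex_vector.subspace_def
    by (auto simp: N_def add scale cinner_add_left cinner_scaleC_left)
  ultimately have N: "closed_csubspace N"
    by (simp add: closed_csubspace_def)
  have "\<exists>x\<in>S. \<forall>z\<in>S. cinner (T z) y = cinner z x"
  proof (cases "N = S")
    case True
    then show ?thesis
      by (intro bexI[of _ 0] complex_vector.subspace_0 sub) (auto simp: N_def)
  next
    case False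
    then obtain z0 where z0: "z0 \<in> S" "cinner (T z0) y \<noteq> 0"
      by (auto simp: N_def)
    define n where "n = z0 - proj N z0"
    have pN: "proj N z0 \<in> S" "cinner (T (proj N z0)) y = 0"
      using proj_in[OF N, of z0] by (auto simp: N_def)
    have n: "n \<in> S" "cinner (T n) y \<noteq> 0"
      using z0 pN by (auto simp: n_def diff cinner_diff_left complex_vector.subspace_diff[OF sub])
    then have n0: "cinner n n \<noteq> 0"
      using scale[of 0 0] complex_vector.subspace_0[OF sub] by auto
    have orth: "cinner w n = 0" if "w \<in> N" for w
      by (subst cinner_eq_zero_commute) (simp add: n_def cinner_diff_left cinner_proj[OF N that])
    \<comment> \<open>\<open>n\<close> is orthogonal to the kernel, and the scalar is chosen to
      match the functional at \<open>n\<close>; it is conjugated because \<open>cinner\<close> is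
      antilinear in its second argument.\<close>
    have "cinner (T z) y = cinner z (cnj (cinner (T n) y / cinner n n) *\<^sub>C n)" if z: "z \<in> S" for z
    proof -
      \<comment> \<open>Cross-multiplying the values of the functional at \<open>z\<close> and
        \<open>n\<close> puts this combination in its kernel.\<close>
      have "cinner (T n) y *\<^sub>C z - cinner (T z) y *\<^sub>C n \<in> N"
        using z n(1) by (simp add: N_def diff scale cinner_diff_left cinner_scaleC_left
            complex_vector.subspace_diff[OF sub] complex_vector.subspace_scale[OF sub])
      from orth[OF this] have "cinner (T n) y * cinner z n = cinner (T z) y * cinner n n"
        by (simp add: cinner_diff_left cinner_scaleC_left)
      then show ?thesis
        using n0 by (simp add: cinner_scaleC_right field_simps)
    qed
    then show ?thesis
      using complex_vector.subspace_scale[OF sub n(1)] by blast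
  qed
  then obtain x where x: "x \<in> S" "\<And>z. z \<in> S \<Longrightarrow> cinner (T z) y = cinner z x"
    by blast
  then have "adj_on S T y = x"
    by (intro adj_on_eqI sub) auto
  then show "adj_on S T y \<in> S" "z \<in> S \<Longrightarrow> cinner (T z) y = cinner z (adj_on S T y)"
    using x by auto
qed

lemma adj_on_clinear:
  assumes S: "closed_csubspace S" and T: "clinear_on S T" "\<And>x. x \<in> S \<Longrightarrow> norm (T x) \<le> norm x"
  shows "adj_on S T (x + y) = adj_on S T x + adj_on S T y" "adj_on S T (a *\<^sub>C x) = a *\<^sub>C adj_on S T x"
proof -
  have sub: "csubspace S"
    using S by (simp add: closed_csubspace_def)
  note * = adj_on_in[OF S T] cinner_adj_on[OF S T]
  show "adj_on S T (x + y) = adj_on S T x + adj_on S T y"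
    by (intro adj_on_eqI sub complex_vector.subspace_add) (simp_all add: * cinner_add_right)
  show "adj_on S T (a *\<^sub>C x) = a *\<^sub>C adj_on S T x"
    by (intro adj_on_eqI sub complex_vector.subspace_scale) (simp_all add: * cinner_scaleC_right)
qed

section \<open>Closed linear spans and orthogonal complements\<close>

lemma closed_csubspace_cspan_closure: "closed_csubspace (cspan_closure S)"
proof -
  have "x + y \<in> closure (cspan S)" if x: "x \<in> closure (cspan S)" and y: "y \<in> closure (cspan S)" for x y
  proof -
    obtain u where "\<And>n. u n \<in> cspan S" "u \<longlonglongrightarrow> x"
      using x by (auto simp: closure_sequential)
    moreover obtain v where "\<And>n. v n \<in> cspan S" "v \<longlonglongrightarrow> y"
      using y by (auto simp: closure_sequential)
    ultimately show ?thesis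
      unfolding closure_sequential
      by (intro exI[of _ "\<lambda>n. u n + v n"]) (auto intro: tendsto_add complex_vector.span_add)
  qed
  moreover have "a *\<^sub>C x \<in> closure (cspan S)" if x: "x \<in> closure (cspan S)" for a x
  proof -
    obtain u where "\<And>n. u n \<in> cspan S" "u \<longlonglongrightarrow> x"
      using x by (auto simp: closure_sequential)
    then show ?thesis
      unfolding closure_sequential
      by (intro exI[of _ "\<lambda>n. a *\<^sub>C u n"])
        (auto intro: bounded_linear.tendsto[OF bounded_linear_scaleC] complex_vector.span_scale)
  qed
  moreover have "0 \<in> closure (cspan S)"
    using complex_vector.span_zero closure_subset by blast
  ultimately show ?thesis
    by (auto simp: closed_csubspace_def cspan_closure_def complex_vector.subspace_def)
qed

lemma cspan_closure_base: "x \<in> S \<Longrightarrow> x \<in> cspan_closure S"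
  unfolding cspan_closure_def using closure_subset complex_vector.span_base by blast

lemma cspan_closure_minimal: "S \<subseteq> T \<Longrightarrow> closed_csubspace T \<Longrightarrow> cspan_closure S \<subseteq> T"
  unfolding cspan_closure_def closed_csubspace_def
  by (simp add: closure_minimal complex_vector.span_minimal)

text \<open>An intersection of \<open>S\<close> with kernels of continuous functionals, whatever the
  set \<open>T\<close> is.\<close>

lemma closed_csubspace_ominus:
  assumes S: "closed_csubspace S"
  shows "closed_csubspace (S \<ominus> T)"
proof -
  have sub: "csubspace S" and cl: "closed S"
    using S by (auto simp: closed_csubspace_def)
  have "S \<ominus> T = S \<inter> (\<Inter>z\<in>T. {x. cinner x z = 0})"
    by (auto simp: ominus_def)
  moreover have "closed {x. cinner x z = 0}" for z :: 'a
    by (intro closed_Collect_eq bounded_linear.continuous_on[OF bounded_linear_cinner_left]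
        continuous_intros)
  ultimately have "closed (S \<ominus> T)"
    using cl by (simp add: closed_INT closed_Int)
  moreover have "csubspace (S \<ominus> T)"
    using sub unfolding complex_vector.subspace_def
    by (auto simp: ominus_def cinner_add_left cinner_scaleC_left)
  ultimately show ?thesis
    by (simp add: closed_csubspace_def)
qed


section \<open>Square roots\<close>

text \<open>The Taylor coefficients of \<open>sqrt (1 - z)\<close>.\<close>

definition sqrt_coeff :: "nat \<Rightarrow> real"
  where "sqrt_coeff n = (- 1) ^ n * ((1 / 2) gchoose n)"

lemma sqrt_coeff_0 [simp]: "sqrt_coeff 0 = 1"
  by (simp add: sqrt_coeff_def)

text \<open>The absorption identities of binomial coefficients; the alternating sign turns
  \<open>1 / 2 - n\<close> into \<open>n - 1 / 2\<close>.\<close>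

lemma sqrt_coeff_Suc: "real (Suc n) * sqrt_coeff (Suc n) = (real n - 1 / 2) * sqrt_coeff n"
proof -
  have "real (Suc n) * sqrt_coeff (Suc n) = (- 1) ^ Suc n * (real (Suc n) * ((1 / 2) gchoose Suc n))"
    by (simp only: sqrt_coeff_def mult.left_commute)
  also have "\<dots> = (- 1) ^ Suc n * ((1 / 2 - real n) * ((1 / 2) gchoose n))"
    using gbinomial_absorb_comp[of "1/2 :: real" n] gbinomial_absorption[of n "1/2 :: real"] by simp
  also have "\<dots> = (real n - 1 / 2) * sqrt_coeff n"
    by (simp add: sqrt_coeff_def algebra_simps)
  finally show ?thesis .
qed

text \<open>The factor \<open>n - 1 / 2\<close> in \<open>sqrt_coeff_Suc\<close> is negative only
  for \<open>n = 0\<close>, which makes the first coefficient \<open>- 1 / 2\<close>; the later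
  factors keep that sign.\<close>

lemma sqrt_coeff_nonpos: "sqrt_coeff (Suc n) \<le> 0"
proof (induction n)
  case 0
  show ?case
    using sqrt_coeff_Suc[of 0] by simp
next
  case (Suc n)
  have "real (Suc (Suc n)) * sqrt_coeff (Suc (Suc n)) \<le> 0"
    unfolding sqrt_coeff_Suc[of "Suc n"] using Suc by (intro mult_nonneg_nonpos) auto
  then show ?case
    by (simp add: mult_le_0_iff)
qed

text \<open>With \<open>sqrt_coeff_nonpos\<close> this closed form makes the partial sums
  nonnegative, which yields both absolute summability and positivity of the root.\<close>

lemma sum_sqrt_coeff: "(\<Sum>i\<le>n. sqrt_coeff i) = - 2 * real (Suc n) * sqrt_coeff (Suc n)"
proof (induction n)
  case 0
  show ?case
    using sqrt_coeff_Suc[of 0] by simp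
next
  case (Suc n)
  show ?case
    using Suc sqrt_coeff_Suc[of "Suc n"] by (simp add: algebra_simps)
qed

lemma sum_sqrt_coeff_nonneg: "0 \<le> (\<Sum>i\<le>n. sqrt_coeff i)"
  unfolding sum_sqrt_coeff using sqrt_coeff_nonpos[of n] by (intro mult_nonpos_nonpos) auto

lemma summable_abs_sqrt_coeff: "summable (\<lambda>n. \<bar>sqrt_coeff n\<bar>)"
proof (rule summableI_nonneg_bounded[where x = 2])
  fix n
  \<comment> \<open>Only the constant coefficient \<open>1 = 2 - 1\<close> is positive; for all
    others the absolute value just changes the sign.\<close>
  have eq: "\<bar>sqrt_coeff i\<bar> = (if i = 0 then 2 else 0) - sqrt_coeff i" for i
    using sqrt_coeff_nonpos[of "i - 1"] by (cases i) auto
  have "(\<Sum>i<n. \<bar>sqrt_coeff i\<bar>) \<le> (\<Sum>i\<le>n. \<bar>sqrt_coeff i\<bar>)"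
    by (intro sum_mono2) auto
  also have "\<dots> = 2 - (\<Sum>i\<le>n. sqrt_coeff i)"
    unfolding eq sum_subtractf by simp
  finally show "(\<Sum>i<n. \<bar>sqrt_coeff i\<bar>) \<le> 2"
    using sum_sqrt_coeff_nonneg[of n] by linarith
qed simp

text \<open>The square of the series is \<open>1 - z\<close>: Vandermonde's identity for
  \<open>1 / 2 + 1 / 2\<close>, then \<open>1 choose n = 0\<close> for \<open>n > 1\<close>.\<close>

lemma sqrt_coeff_convolution:
  "(\<Sum>i\<le>n. sqrt_coeff i * sqrt_coeff (n - i)) = (if n = 0 then 1 else if n = 1 then - 1 else 0)"
proof -
  have "(\<Sum>i\<le>n. sqrt_coeff i * sqrt_coeff (n - i))
      = (\<Sum>i\<le>n. (- 1) ^ n * (((1 / 2) gchoose i) * ((1 / 2) gchoose (n - i))))"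
  proof (rule sum.cong)
    fix i assume "i \<in> {..n}"
    then have "(- 1 :: real) ^ n = (- 1) ^ i * (- 1) ^ (n - i)"
      by (simp flip: power_add)
    then show "sqrt_coeff i * sqrt_coeff (n - i)
        = (- 1) ^ n * (((1 / 2) gchoose i) * ((1 / 2) gchoose (n - i)))"
      by (simp add: sqrt_coeff_def)
  qed simp
  also have "\<dots> = (- 1) ^ n * ((1 :: real) gchoose n)"
    using gbinomial_Vandermonde[of "1/2 :: real" "1/2" n]
    by (simp add: sum_distrib_left[symmetric] atLeast0AtMost)
  also have "(1 :: real) gchoose n = of_nat (1 choose n)"
    using binomial_gbinomial[of 1 n, where ?'a = real] by simp
  finally show ?thesis
    by (auto simp: binomial_eq_0)
qed

text \<open>The binomial series of \<open>sqrt (1 - T)\<close>. It converges absolutely because the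
  powers of \<open>T\<close> are contractions, so its square may be regrouped by total
  degree.\<close>

lemma sqrt_series_square:
  fixes T :: "'a::chilbert_space \<Rightarrow> 'a"
  assumes T: "bounded_linear T" "\<And>x. norm (T x) \<le> norm x"
  defines "R \<equiv> \<lambda>x. \<Sum>n. sqrt_coeff n *\<^sub>R (T ^^ n) x"
  shows sqrt_series_sums: "(\<lambda>n. sqrt_coeff n *\<^sub>R (T ^^ n) x) sums R x"
    and sqrt_series_sqrt: "R (R x) = x - T x"
proof -
  have nT: "norm ((T ^^ n) x) \<le> norm x" for n x
    by (induction n) (auto intro: order_trans[OF T(2)])
  have abs: "summable (\<lambda>n. norm (sqrt_coeff n *\<^sub>R (T ^^ n) x))" for x
  proof (rule summable_comparison_test)
    show "summable (\<lambda>n. \<bar>sqrt_coeff n\<bar> * norm x)"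
      by (intro summable_mult2 summable_abs_sqrt_coeff)
  qed (auto intro!: exI mult_left_mono nT)
  show sums: "(\<lambda>n. sqrt_coeff n *\<^sub>R (T ^^ n) x) sums R x" for x
    unfolding R_def by (rule summable_sums[OF summable_norm_cancel[OF abs]])
  have R: "R x = (\<Sum>\<^sub>\<infinity>n. sqrt_coeff n *\<^sub>R (T ^^ n) x)" for x
    by (intro infsumI[symmetric] norm_summable_imp_has_sum abs sums)
  have summ: "(\<lambda>n. sqrt_coeff n *\<^sub>R (T ^^ n) x) summable_on UNIV" for x
    by (rule norm_summable_imp_summable_on[OF abs])
  have blT: "bounded_linear (T ^^ n)" for n
    by (induction n) (auto simp: id_def o_def intro: bounded_linear_compose[OF T(1)] bounded_linear_ident)
  define F where "F = (\<lambda>(m, n). (sqrt_coeff m * sqrt_coeff n) *\<^sub>R (T ^^ (m + n)) x)"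
  have "(\<lambda>(m, n). \<bar>sqrt_coeff m\<bar> * (\<bar>sqrt_coeff n\<bar> * norm x)) summable_on UNIV \<times> UNIV"
  proof (rule summable_on_SigmaI)
    have c: "(\<lambda>n. \<bar>sqrt_coeff n\<bar>) summable_on UNIV"
      using norm_summable_imp_summable_on[of "\<lambda>n. \<bar>sqrt_coeff n\<bar>"] summable_abs_sqrt_coeff by simp
    show "((\<lambda>n. case (m, n) of (m, n) \<Rightarrow> \<bar>sqrt_coeff m\<bar> * (\<bar>sqrt_coeff n\<bar> * norm x))
        has_sum \<bar>sqrt_coeff m\<bar> * ((\<Sum>\<^sub>\<infinity>n. \<bar>sqrt_coeff n\<bar>) * norm x)) UNIV" for m
      by (simp add: has_sum_cmult_right has_sum_cmult_left c)
    show "(\<lambda>m. \<bar>sqrt_coeff m\<bar> * ((\<Sum>\<^sub>\<infinity>n. \<bar>sqrt_coeff n\<bar>) * norm x)) summable_on UNIV"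
      by (intro summable_on_cmult_left c)
  qed auto
  then have "F abs_summable_on UNIV \<times> UNIV"
    by (rule Infinite_Sum.abs_summable_on_comparison_test')
      (auto simp: F_def abs_mult mult.assoc intro!: mult_left_mono nT)
  then have sF: "F summable_on UNIV \<times> UNIV"
    by (rule abs_summable_summable)
  \<comment> \<open>The pairs \<open>(i, n - i)\<close> with \<open>i \<le> n\<close> are those of
    total degree \<open>n\<close>; the bound keeps the subtraction on naturals exact.\<close>
  have inj: "inj_on (\<lambda>(n, i). (i, n - i)) (SIGMA n:UNIV. {..n :: nat})"
    by (auto simp: inj_on_def)
  have img: "(\<lambda>(n, i). (i, n - i)) ` (SIGMA n:UNIV. {..n :: nat}) = UNIV \<times> UNIV"
  proof -
    have "(m, n) \<in> (\<lambda>(n, i). (i, n - i)) ` (SIGMA n:UNIV. {..n})" for m n :: nat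
      by (rule image_eqI[of _ _ "(m + n, m)"]) auto
    then show ?thesis
      by auto
  qed
  have sF': "(F \<circ> (\<lambda>(n, i). (i, n - i))) summable_on (SIGMA n:UNIV. {..n})"
    using summable_on_reindex[OF inj, of F] sF by (simp only: img)
  have "R (R x) = (\<Sum>\<^sub>\<infinity>m. sqrt_coeff m *\<^sub>R (T ^^ m) (\<Sum>\<^sub>\<infinity>n. sqrt_coeff n *\<^sub>R (T ^^ n) x))"
    by (simp only: R)
  also have "\<dots> = (\<Sum>\<^sub>\<infinity>m. \<Sum>\<^sub>\<infinity>n. F (m, n))"
  proof (rule infsum_cong)
    fix m
    have "bounded_linear (\<lambda>y. sqrt_coeff m *\<^sub>R (T ^^ m) y)"
      by (intro bounded_linear_scaleR_right bounded_linear_const_scaleR blT)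
    from has_sum_bounded_linear[OF this has_sum_infsum[OF summ[of x]]]
    show "sqrt_coeff m *\<^sub>R (T ^^ m) (\<Sum>\<^sub>\<infinity>n. sqrt_coeff n *\<^sub>R (T ^^ n) x) = (\<Sum>\<^sub>\<infinity>n. F (m, n))"
      using linear_scale[OF bounded_linear.linear[OF blT[of m]]]
      by (intro infsumI[symmetric]) (simp add: F_def o_def funpow_add)
  qed
  also have "\<dots> = infsum F (UNIV \<times> UNIV)"
    using infsum_Sigma'_banach[of "\<lambda>m n. F (m, n)" UNIV "\<lambda>_. UNIV"] sF by simp
  also have "\<dots> = infsum F ((\<lambda>(n, i). (i, n - i)) ` (SIGMA n:UNIV. {..n}))"
    by (simp only: img)
  also have "\<dots> = infsum (F \<circ> (\<lambda>(n, i). (i, n - i))) (SIGMA n:UNIV. {..n})"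
    by (rule infsum_reindex[OF inj])
  also have "\<dots> = (\<Sum>\<^sub>\<infinity>n. \<Sum>\<^sub>\<infinity>i\<in>{..n}. F (i, n - i))"
    using infsum_Sigma'_banach[of "\<lambda>n i. F (i, n - i)" UNIV "\<lambda>n. {..n}"] sF'
    by (simp add: o_def case_prod_unfold)
  also have "\<dots> = (\<Sum>\<^sub>\<infinity>n. (\<Sum>i\<le>n. sqrt_coeff i * sqrt_coeff (n - i)) *\<^sub>R (T ^^ n) x)"
    by (intro infsum_cong) (simp add: F_def scaleR_sum_left)
  also have "\<dots> = (\<Sum>\<^sub>\<infinity>n\<in>{0, 1}. (\<Sum>i\<le>n. sqrt_coeff i * sqrt_coeff (n - i)) *\<^sub>R (T ^^ n) x)"
    by (rule infsum_cong_neutral) (auto simp: sqrt_coeff_convolution)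
  also have "\<dots> = x - T x"
    by (simp add: sqrt_coeff_convolution)
  finally show "R (R x) = x - T x" .
qed

text \<open>The definition of \<open>sqrt_on\<close> provides only a real quadratic form; over the
  complex numbers polarisation turns this into symmetry.\<close>

lemma cinner_symmetric_if_real:
  assumes S: "csubspace S" and R: "clinear_on S R" and real: "\<And>x. x \<in> S \<Longrightarrow> cinner (R x) x \<in> \<real>"
    and x: "x \<in> S" and y: "y \<in> S"
  shows "cinner (R x) y = cinner x (R y)"
proof -
  have add: "R (u + v) = R u + R v" if "u \<in> S" "v \<in> S" for u v
    using R that by (auto simp: clinear_on_def)
  have scale: "R (a *\<^sub>C u) = a *\<^sub>C R u" if "u \<in> S" for a u
    using R that by (auto simp: clinear_on_def)
  have polar: "Im (cinner (R u) v + cinner (R v) u) = 0" if "u \<in> S" "v \<in> S" for u v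
  proof -
    have "Im (cinner (R (u + v)) (u + v)) = 0" "Im (cinner (R u) u) = 0" "Im (cinner (R v) v) = 0"
      using real that complex_vector.subspace_add[OF S] by (auto simp: complex_is_Real_iff)
    then show ?thesis
      using that by (simp add: add cinner_add_left cinner_add_right)
  qed
  \<comment> \<open>Polarisation at \<open>\<i> *\<^sub>C x\<close> and \<open>y\<close> yields the
    statement on real parts.\<close>
  have "Im (cinner (R x) y + cinner (R y) x) = 0" "Re (cinner (R x) y - cinner (R y) x) = 0"
    using polar[OF x y] polar[of "\<i> *\<^sub>C x" y] x y
    by (simp_all add: scale cinner_scaleC_left cinner_scaleC_right complex_vector.subspace_scale[OF S])
  then have "cinner (R x) y = cnj (cinner (R y) x)"
    by (simp add: complex_eq_iff)
  then show ?thesis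
    by (metis cinner_commute)
qed

text \<open>Supplies a witness for the \<open>SOME\<close> in \<open>sqrt_on\<close>, namely the
  binomial series.\<close>

lemma sqrt_on_exists:
  fixes T :: "'a::chilbert_space \<Rightarrow> 'a"
  assumes S: "closed_csubspace S"
    and T: "clinear_on S T" "\<And>x. x \<in> S \<Longrightarrow> T x \<in> S" "\<And>x. x \<in> S \<Longrightarrow> norm (T x) \<le> norm x"
    and sym: "\<And>x y. x \<in> S \<Longrightarrow> y \<in> S \<Longrightarrow> cinner (T x) y = cinner x (T y)"
  shows "\<exists>R. clinear_on S R \<and> R ` S \<subseteq> S \<and> (\<forall>x\<in>S. cinner (R x) x \<in> \<real>\<^sub>\<ge>\<^sub>0) \<and> (\<forall>x\<in>S. R (R x) = x - T x)"
proof -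
  have sub: "csubspace S" and cl: "closed S"
    using S by (auto simp: closed_csubspace_def)
  \<comment> \<open>The series needs a contraction on the whole type, while \<open>T\<close> is
    constrained on \<open>S\<close> alone; the projection extends it without changing it on
    \<open>S\<close>.\<close>
  define T' where "T' = (\<lambda>x. T (proj S x))"
  have T'_S: "T' x \<in> S" for x
    by (simp add: T'_def T proj_in[OF S])
  have T'_add: "T' (x + y) = T' x + T' y" and T'_scale: "T' (a *\<^sub>C x) = a *\<^sub>C T' x" for x y a
    using T(1) proj_in[OF S] by (auto simp: T'_def proj_clinear[OF S] clinear_on_def)
  have T'_norm: "norm (T' x) \<le> norm x" for x
    unfolding T'_def by (rule order_trans[OF T(3)[OF proj_in[OF S]] norm_proj_le[OF S]])
  have T'_sym: "cinner (T' x) y = cinner x (T' y)" for x y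
  proof -
    have "cinner (T' x) y = cinner (T' x) (proj S y)"
      by (simp add: cinner_proj_right[OF S T'_S])
    also have "\<dots> = cinner (proj S x) (T' y)"
      by (simp add: T'_def sym proj_in[OF S])
    also have "\<dots> = cinner x (T' y)"
      by (rule cinner_proj[OF S T'_S])
    finally show ?thesis .
  qed
  have bl: "bounded_linear T'"
  proof (rule bounded_linear_intro[where K = 1])
    show "T' (r *\<^sub>R x) = r *\<^sub>R T' x" for r x
      using T'_scale[of "complex_of_real r" x] by (simp add: scaleC_of_real)
  qed (simp_all add: T'_add T'_norm)
  define R where "R = (\<lambda>x. \<Sum>n. sqrt_coeff n *\<^sub>R (T' ^^ n) x)"
  have sums: "(\<lambda>n. sqrt_coeff n *\<^sub>R (T' ^^ n) x) sums R x" for x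
    unfolding R_def by (rule sqrt_series_sums[OF bl T'_norm])
  have pow_add: "(T' ^^ n) (x + y) = (T' ^^ n) x + (T' ^^ n) y"
    and pow_scale: "(T' ^^ n) (a *\<^sub>C x) = a *\<^sub>C (T' ^^ n) x"
    and pow_sym: "cinner ((T' ^^ n) x) y = cinner x ((T' ^^ n) y)"
    and pow_norm: "norm ((T' ^^ n) x) \<le> norm x"
    and pow_S: "x \<in> S \<Longrightarrow> (T' ^^ n) x \<in> S" for n x y a
  proof (induction n arbitrary: x y)
    case (Suc n)
    case 1 show ?case by (simp add: Suc T'_add)
    case 2 show ?case by (simp add: Suc T'_scale)
    case 3 show ?case using Suc(3)[of "T' x" y] by (simp add: funpow_swap1 T'_sym)
    case 4 show ?case using Suc(4)[of x] T'_norm order_trans by auto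
    case 5 show ?case by (simp add: T'_S)
  qed simp_all
  have R_add: "R (x + y) = R x + R y" for x y
    by (rule sums_unique2[OF sums])
      (use sums_add[OF sums[of x] sums[of y]] in \<open>simp add: pow_add scaleR_add_right\<close>)
  have R_scale: "R (a *\<^sub>C x) = a *\<^sub>C R x" for a x
    by (rule sums_unique2[OF sums])
      (use bounded_linear.sums[OF bounded_linear_scaleC sums[of x], of a] in
        \<open>simp add: pow_scale scaleC_of_real[symmetric] scaleC_scaleC mult.commute\<close>)
  have R_S: "R x \<in> S" if x: "x \<in> S" for x
  proof (rule closed_sequentially[OF cl])
    show "(\<lambda>N. \<Sum>n<N. sqrt_coeff n *\<^sub>R (T' ^^ n) x) \<longlonglongrightarrow> R x"
      using sums[of x] by (simp add: sums_def)
    show "(\<Sum>n<N. sqrt_coeff n *\<^sub>R (T' ^^ n) x) \<in> S" for N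
      by (intro complex_vector.subspace_sum sub csubspace_scaleR pow_S x)
  qed
  have R_pos: "cinner (R x) x \<in> \<real>\<^sub>\<ge>\<^sub>0" for x
  proof -
    have "Im (cinner ((T' ^^ n) x) x) = 0" for n
      using arg_cong[OF pow_sym[of n x x], of Im] arg_cong[OF cinner_commute[of x "(T' ^^ n) x"], of Im]
      by simp
    then have c: "cinner ((T' ^^ n) x) x = complex_of_real (inner ((T' ^^ n) x) x)" for n
      by (simp add: complex_eq_iff Re_cinner)
    have s: "(\<lambda>n. complex_of_real (sqrt_coeff n * inner ((T' ^^ n) x) x)) sums cinner (R x) x"
      using bounded_linear.sums[OF bounded_linear_cinner_left sums[of x], of x]
      by (simp add: scaleC_of_real[symmetric] cinner_scaleC_left c)
    \<comment> \<open>For \<open>n > 0\<close> the coefficient is nonpositive and the inner product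
      is at most \<open>(norm x)\<^sup>2\<close>; for \<open>n = 0\<close> they agree. So the sum is
      at least \<open>(norm x)\<^sup>2\<close> times a partial sum of coefficients.\<close>
    have "0 \<le> (\<Sum>n\<le>N. sqrt_coeff n * inner ((T' ^^ n) x) x)" for N
    proof -
      have "0 \<le> (\<Sum>n\<le>N. sqrt_coeff n) * (norm x)\<^sup>2"
        by (intro mult_nonneg_nonneg sum_sqrt_coeff_nonneg) simp
      also have "\<dots> = (\<Sum>n\<le>N. sqrt_coeff n * (norm x)\<^sup>2)"
        by (rule sum_distrib_right)
      also have "\<dots> \<le> (\<Sum>n\<le>N. sqrt_coeff n * inner ((T' ^^ n) x) x)"
      proof (rule sum_mono)
        fix n
        have "inner ((T' ^^ n) x) x \<le> norm ((T' ^^ n) x) * norm x"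
          by (rule norm_cauchy_schwarz)
        also have "\<dots> \<le> (norm x)\<^sup>2"
          using pow_norm[of n x] by (simp add: power2_eq_square mult_right_mono)
        finally show "sqrt_coeff n * (norm x)\<^sup>2 \<le> sqrt_coeff n * inner ((T' ^^ n) x) x"
          using sqrt_coeff_nonpos[of "n - 1"]
          by (cases n) (simp_all add: power2_norm_eq_inner mult_left_mono_neg)
      qed
      finally show ?thesis .
    qed
    then have "(\<Sum>n\<le>N. complex_of_real (sqrt_coeff n * inner ((T' ^^ n) x) x)) \<in> \<real>\<^sub>\<ge>\<^sub>0" for N
      by (simp only: of_real_sum[symmetric] nonneg_Reals_of_real_iff)
    moreover have "(\<lambda>N. \<Sum>n\<le>N. complex_of_real (sqrt_coeff n * inner ((T' ^^ n) x) x))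
        \<longlonglongrightarrow> cinner (R x) x"
      using s by (simp only: sums_def_le)
    ultimately show ?thesis
      by (rule closed_sequentially[OF closed_nonneg_Reals_complex])
  qed
  have "R (R x) = x - T x" if "x \<in> S" for x
    using sqrt_series_sqrt[OF bl T'_norm, of x] that
    by (simp add: R_def T'_def proj_self[OF S])
  then show ?thesis
    using R_add R_scale R_S R_pos by (intro exI[of _ R]) (auto simp: clinear_on_def)
qed

text \<open>Whichever root \<open>SOME\<close> picks, it is symmetric by
  \<open>cinner_symmetric_if_real\<close>, so one factor moves across and
  \<open>R (R x) = x - T x\<close> applies.\<close>

lemma sqrt_on_properties:
  fixes T :: "'a::chilbert_space \<Rightarrow> 'a"
  assumes S: "closed_csubspace S"
    and T: "clinear_on S T" "\<And>x. x \<in> S \<Longrightarrow> T x \<in> S" "\<And>x. x \<in> S \<Longrightarrow> norm (T x) \<le> norm x"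
    and sym: "\<And>x y. x \<in> S \<Longrightarrow> y \<in> S \<Longrightarrow> cinner (T x) y = cinner x (T y)"
  defines "R \<equiv> sqrt_on S (\<lambda>x. x - T x)"
  shows clinear_on_sqrt_on: "clinear_on S R"
    and cinner_sqrt_on: "x \<in> S \<Longrightarrow> y \<in> S \<Longrightarrow> cinner (R x) (R y) = cinner x y - cinner (T x) y"
proof -
  have R: "clinear_on S R \<and> R ` S \<subseteq> S \<and> (\<forall>x\<in>S. cinner (R x) x \<in> \<real>\<^sub>\<ge>\<^sub>0) \<and> (\<forall>x\<in>S. R (R x) = x - T x)"
    unfolding R_def sqrt_on_def by (rule someI_ex[OF sqrt_on_exists[OF S T sym]])
  show "clinear_on S R"
    using R by simp
  assume xy: "x \<in> S" "y \<in> S"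
  have "cinner (R (R x)) y = cinner (R x) (R y)"
  proof (rule cinner_symmetric_if_real[of S R])
    show "cinner (R z) z \<in> \<real>" if "z \<in> S" for z
      using R that nonneg_Reals_subset_Reals by blast
  qed (use R S xy in \<open>auto simp: closed_csubspace_def\<close>)
  then show "cinner (R x) (R y) = cinner x y - cinner (T x) y"
    using R xy by (simp add: cinner_diff_left)
qed


section \<open>Row isometries and processes\<close>

text \<open>Polarisation for the real inner product; the imaginary part follows with
  \<open>\<i> *\<^sub>C x\<close>.\<close>

lemma isometry_cinner:
  assumes S: "csubspace S" and T: "clinear_on S T" "\<And>x. x \<in> S \<Longrightarrow> norm (T x) = norm x"
    and "x \<in> S" "y \<in> S"
  shows "cinner (T x) (T y) = cinner x y"
proof -
  have re: "inner (T u) (T v) = inner u v" if "u \<in> S" "v \<in> S" for u v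
  proof -
    have "T (u + v) = T u + T v"
      using T(1) that by (auto simp: clinear_on_def)
    then show ?thesis
      using T(2)[OF that(1)] T(2)[OF that(2)] T(2)[OF complex_vector.subspace_add[OF S that]]
      by (simp add: dot_norm)
  qed
  have "T (\<i> *\<^sub>C x) = \<i> *\<^sub>C T x"
    using T(1) assms by (auto simp: clinear_on_def)
  then show ?thesis
    using re[of x y] re[of "\<i> *\<^sub>C x" y] assms complex_vector.subspace_scale[OF S]
    by (simp add: complex_eq_iff Re_cinner Im_cinner)
qed

lemma csubspace_image:
  assumes T: "clinear_on S T" and S: "csubspace S"
  shows "csubspace (T ` S)"
proof -
  have "T (0 *\<^sub>C 0) = 0"
    using T complex_vector.subspace_0[OF S] unfolding clinear_on_def
    by (metis complex_vector.scale_zero_left)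
  then have "0 \<in> T ` S"
    using complex_vector.subspace_0[OF S] by (simp add: image_iff) metis
  moreover have "T x + T y \<in> T ` S" if "x \<in> S" "y \<in> S" for x y
    using T complex_vector.subspace_add[OF S that] that unfolding clinear_on_def
    by (metis imageI)
  moreover have "a *\<^sub>C T x \<in> T ` S" if "x \<in> S" for x a
    using T complex_vector.subspace_scale[OF S that] that unfolding clinear_on_def
    by (metis imageI)
  ultimately show ?thesis
    unfolding complex_vector.subspace_def by blast
qed

lemma clinear_on_subset: "clinear_on S T \<Longrightarrow> S' \<subseteq> S \<Longrightarrow> clinear_on S' T"
  unfolding clinear_on_def by blast

lemma csubspace_Times: "csubspace S \<Longrightarrow> csubspace T \<Longrightarrow> csubspace (S \<times> T)"
  unfolding complex_vector.subspace_def by (auto simp: scaleC_prod_def zero_prod_def)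

lemma csubspace_copies: "csubspace S \<Longrightarrow> csubspace (copies S)"
  unfolding complex_vector.subspace_def
  by (auto simp: copies_def coord_add coord_zero coord_scaleC)

lemma copy_in_copies: "csubspace S \<Longrightarrow> x \<in> S \<Longrightarrow> copy i x \<in> copies S"
  by (simp add: copies_def coord_copy complex_vector.subspace_0)

lemma copy_add: "copy i (x + y) = copy i x + copy i y"
  by (rule l2sum_eqI) (simp add: coord_copy coord_add)

lemma copy_scaleC: "copy i (a *\<^sub>C x) = a *\<^sub>C copy i x"
  by (rule l2sum_eqI) (simp add: coord_copy coord_scaleC)

lemma cinner_copy: "cinner (copy i x) f = cinner x (coord f i)"
proof -
  have "cinner (copy i x) f = (\<Sum>\<^sub>\<infinity>j\<in>{i}. cinner x (coord f j))"
    unfolding cinner_l2sum_def by (rule infsum_cong_neutral) (auto simp: coord_copy)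
  then show ?thesis
    by simp
qed

lemma norm_copy: "norm (copy i x) = norm x"
proof -
  have "complex_of_real ((norm (copy i x))\<^sup>2) = complex_of_real ((norm x)\<^sup>2)"
    by (simp only: cinner_self[symmetric] cinner_copy coord_copy simp_thms if_True)
  then show ?thesis
    by (simp add: power2_eq_iff_nonneg del: of_real_power)
qed

lemma map_l2sum_copy:
  assumes "\<And>x. norm (\<phi> x) \<le> norm x"
  shows "map_l2sum \<phi> (copy i x) = copy i (\<phi> x)"
proof (rule l2sum_eqI)
  have "\<phi> 0 = 0"
    using assms[of 0] by simp
  then show "coord (map_l2sum \<phi> (copy i x)) j = coord (copy i (\<phi> x)) j" for j
    by (simp add: coord_map_l2sum[OF assms] coord_copy)
qed

section \<open>Letter operators of a process and their adjoints\<close>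

context
  fixes H V h
  assumes process: "is_process (H, V, h)"
begin

lemma process_subspaces: "closed_csubspace H" "closed_csubspace h" "csubspace H" "csubspace h" "h \<subseteq> H"
  using process by (auto simp: closed_csubspace_def)

lemma clinear_on_letter_op: "clinear_on H (letter_op V j)"
  using process process_subspaces
  by (auto simp: row_isometry_def clinear_on_def letter_op_def copy_add copy_scaleC copy_in_copies)

lemma norm_letter_op: "x \<in> H \<Longrightarrow> norm (letter_op V j x) = norm x"
  using process process_subspaces
  by (auto simp: row_isometry_def letter_op_def norm_copy copy_in_copies)

lemma adj_letter_op:
  shows adj_letter_op_in: "adj_on H (letter_op V j) y \<in> H"
    and cinner_adj_letter_op: "z \<in> H \<Longrightarrow> cinner (letter_op V j z) y = cinner z (adj_on H (letter_op V j) y)"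
    and adj_letter_op_add: "adj_on H (letter_op V j) (x + y)
      = adj_on H (letter_op V j) x + adj_on H (letter_op V j) y"
  by (rule adj_on_in adj_on_clinear(1) cinner_adj_on;
      simp add: process_subspaces clinear_on_letter_op norm_letter_op)+

lemma cspan_closure_process_subset: "cspan_closure (h \<union> V ` copies h) \<subseteq> H"
proof (rule cspan_closure_minimal[OF _ process_subspaces(1)])
  have "copies h \<subseteq> copies H"
    using process_subspaces(5) by (auto simp: copies_def)
  then show "h \<union> V ` copies h \<subseteq> H"
    using process process_subspaces(5) by (auto simp: row_isometry_def)
qed

text \<open>By coinvariance the vectors orthogonal to \<open>V\<^sub>j (H \<ominus> h)\<close> form a closed subspace containing both
  \<open>h\<close> and \<open>V (h \<otimes> \<P>)\<close>.\<close>

lemma adj_letter_op_in_state_space: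
  assumes e: "e \<in> cspan_closure (h \<union> V ` copies h)"
  shows "adj_on H (letter_op V j) e \<in> h"
proof -
  let ?M = "UNIV \<ominus> letter_op V j ` (H \<ominus> h)"
  have "closed_csubspace (UNIV :: 'a set)"
    by (simp add: closed_csubspace_def)
  then have M: "closed_csubspace ?M"
    by (rule closed_csubspace_ominus)
  have "x \<in> ?M" if "x \<in> h" for x
  proof -
    have "adj_on H (letter_op V j) x \<in> h"
      using process that by (auto simp: coinvariant_def)
    then have "cinner (letter_op V j z) x = 0" if "z \<in> H \<ominus> h" for z
      using that by (simp add: ominus_def cinner_adj_letter_op)
    then show ?thesis
      using cinner_eq_zero_commute by (auto simp: ominus_def)
  qed
  moreover have "V f \<in> ?M" if f: "f \<in> copies h" for f
  proof -
    have "cinner (letter_op V j z) (V f) = 0" if z: "z \<in> H \<ominus> h" for z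
    proof -
      have "cinner (letter_op V j z) (V f) = cinner (copy j z) f"
        unfolding letter_op_def
        by (rule isometry_cinner[OF csubspace_copies[OF process_subspaces(3)]])
          (use process process_subspaces f z in
            \<open>auto simp: row_isometry_def ominus_def copies_def coord_copy complex_vector.subspace_0\<close>)
      also have "\<dots> = 0"
        using f z by (simp add: cinner_copy copies_def ominus_def)
      finally show ?thesis .
    qed
    then show ?thesis
      using cinner_eq_zero_commute by (auto simp: ominus_def)
  qed
  ultimately have "e \<in> ?M"
    using cspan_closure_minimal[OF _ M, of "h \<union> V ` copies h"] e by blast
  then have orth: "cinner z (adj_on H (letter_op V j) e) = 0" if z: "z \<in> H \<ominus> h" for z
  proof -
    have "cinner e (letter_op V j z) = 0"
      using \<open>e \<in> ?M\<close> z by (simp add: ominus_def)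
    then have "cinner (letter_op V j z) e = 0"
      by (subst cinner_eq_zero_commute)
    then show ?thesis
      using z by (simp add: ominus_def cinner_adj_letter_op)
  qed
  \<comment> \<open>\<open>q\<close> is the component of the adjoint orthogonal to \<open>h\<close>.
    It lies in \<open>H \<ominus> h\<close>, so it is orthogonal to \<open>p\<close> as well as to
    \<open>proj h p\<close>, hence to itself.\<close>
  define p where "p = adj_on H (letter_op V j) e"
  define q where "q = p - proj h p"
  have ph: "proj h p \<in> h"
    by (rule proj_in[OF process_subspaces(2)])
  have q: "q \<in> H \<ominus> h"
    using ph process_subspaces adj_letter_op_in[of j e]
    by (auto simp: q_def p_def ominus_def cinner_diff_left cinner_proj intro!: complex_vector.subspace_diff)
  have "cinner q q = cinner q p - cinner q (proj h p)"
    by (simp add: q_def cinner_diff_right)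
  also have "\<dots> = 0"
    using orth[OF q] q ph by (simp add: p_def ominus_def)
  finally show ?thesis
    using ph by (simp add: q_def p_def)
qed

end


section \<open>The extension\<close>

locale process_extension =
  fixes G g :: "'g::chilbert_space set" and VG :: "('d::countable, 'g) l2sum \<Rightarrow> 'g"
    and K k :: "'k::chilbert_space set" and VK :: "('d, 'k) l2sum \<Rightarrow> 'k"
    and \<gamma> :: "'k \<Rightarrow> 'g"
  assumes G: "is_process (G, VG, g)"
    and K: "is_process (K, VK, k)"
    and contr: "contraction_on (defect_space_star (K, VK, k)) (defect_space (G, VG, g)) \<gamma>"
begin

section \<open>The contraction, its adjoint and its defect operator\<close>

definition "E = defect_space (G, VG, g)"
definition "ES = defect_space_star (K, VK, k)"
definition "\<gamma>s = adj_on ES \<gamma>"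
definition "D = defect_op (G, VG, g) \<gamma> (K, VK, k)"
definition "\<iota> = embed_G (G, VG, g) \<gamma> (K, VK, k)"
definition "W = {x + e | x e. x \<in> g \<and> e \<in> E}"
text \<open>Preceding \<open>\<gamma>\<close> by the projection makes it applicable to all of
  \<open>K\<close>; up to the embeddings this is the operator in the support conditions.\<close>

definition "\<gamma>P y = \<gamma> (proj ES y)"

lemma closed_E: "closed_csubspace E"
  by (simp add: E_def closed_csubspace_ominus closed_csubspace_cspan_closure)

lemma closed_ES: "closed_csubspace ES"
  by (simp add: ES_def closed_csubspace_ominus closed_csubspace_cspan_closure)

lemma closed_g: "closed_csubspace g"
  by (rule process_subspaces(2)[OF G])

lemma subspaces: "csubspace E" "csubspace ES" "csubspace g"
  using closed_E closed_ES closed_g by (auto simp: closed_csubspace_def)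

lemma E_orth: "e \<in> E \<Longrightarrow> x \<in> g \<Longrightarrow> cinner e x = 0" "e \<in> E \<Longrightarrow> x \<in> g \<Longrightarrow> cinner x e = 0"
  using cinner_eq_zero_commute by (auto simp: E_def ominus_def)

lemma \<gamma>_contraction: "clinear_on ES \<gamma>" "y \<in> ES \<Longrightarrow> \<gamma> y \<in> E" "y \<in> ES \<Longrightarrow> norm (\<gamma> y) \<le> norm y"
  using contr by (auto simp: contraction_on_def E_def ES_def)

lemma \<gamma>P_in: "\<gamma>P y \<in> E"
  by (simp add: \<gamma>P_def \<gamma>_contraction proj_in[OF closed_ES])

lemma \<gamma>s_in: "\<gamma>s e \<in> ES"
  unfolding \<gamma>s_def by (rule adj_on_in[OF closed_ES \<gamma>_contraction(1) \<gamma>_contraction(3)])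

lemma \<gamma>s_clinear: "\<gamma>s (x + y) = \<gamma>s x + \<gamma>s y" "\<gamma>s (a *\<^sub>C x) = a *\<^sub>C \<gamma>s x"
  unfolding \<gamma>s_def by (rule adj_on_clinear[OF closed_ES \<gamma>_contraction(1) \<gamma>_contraction(3)]; assumption)+

lemma cinner_\<gamma>: "y \<in> ES \<Longrightarrow> cinner (\<gamma> y) e = cinner y (\<gamma>s e)"
  unfolding \<gamma>s_def by (rule cinner_adj_on[OF closed_ES \<gamma>_contraction(1) \<gamma>_contraction(3)])

text \<open>The values of \<open>\<gamma>s\<close> lie in \<open>ES\<close>, so the projection in
  \<open>\<gamma>P\<close> disappears under the pairing.\<close>

lemma cinner_\<gamma>P: "cinner (\<gamma>P y) e = cinner y (\<gamma>s e)" "cinner e (\<gamma>P y) = cinner (\<gamma>s e) y"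
proof -
  show 1: "cinner (\<gamma>P y) e = cinner y (\<gamma>s e)"
    by (simp add: \<gamma>P_def cinner_\<gamma> proj_in[OF closed_ES] cinner_proj[OF closed_ES \<gamma>s_in])
  show "cinner e (\<gamma>P y) = cinner (\<gamma>s e) y"
    by (subst (1 2) cinner_commute) (simp add: 1)
qed

lemma norm_\<gamma>s: "norm (\<gamma>s e) \<le> norm e"
proof (cases "\<gamma>s e = 0")
  case False
  have "(norm (\<gamma>s e))\<^sup>2 = inner (\<gamma> (\<gamma>s e)) e"
    using cinner_\<gamma>[OF \<gamma>s_in, of e e] by (metis Re_cinner power2_norm_eq_inner)
  also have "\<dots> \<le> norm (\<gamma> (\<gamma>s e)) * norm e"
    by (rule norm_cauchy_schwarz)
  also have "\<dots> \<le> norm (\<gamma>s e) * norm e"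
    by (intro mult_right_mono \<gamma>_contraction \<gamma>s_in) simp
  finally show ?thesis
    using False by (simp add: power2_eq_square)
qed simp

text \<open>\<open>\<gamma>\<close> composed with \<open>\<gamma>s\<close> is a symmetric
  contraction of \<open>E\<close>, so the square root lemmas apply. The deficit in
  \<open>cinner_D\<close> is exactly what the \<open>\<gamma>s\<close> component of
  \<open>\<iota>\<close> contributes.\<close>

lemma defect_op_properties:
  shows clinear_on_D: "clinear_on E D"
    and cinner_D: "x \<in> E \<Longrightarrow> y \<in> E \<Longrightarrow> cinner (D x) (D y) = cinner x y - cinner (\<gamma>s x) (\<gamma>s y)"
proof -
  have D: "D = sqrt_on E (\<lambda>e. e - \<gamma> (\<gamma>s e))"
    by (simp add: D_def defect_op_def \<gamma>s_def E_def ES_def)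
  have lin: "clinear_on E (\<lambda>e. \<gamma> (\<gamma>s e))"
    using \<gamma>_contraction(1) \<gamma>s_in by (auto simp: clinear_on_def \<gamma>s_clinear)
  have cin: "cinner (\<gamma> (\<gamma>s x)) y = cinner (\<gamma>s x) (\<gamma>s y)" for x y
    by (rule cinner_\<gamma>[OF \<gamma>s_in])
  have sym: "cinner (\<gamma> (\<gamma>s x)) y = cinner x (\<gamma> (\<gamma>s y))" for x y
    unfolding cin by (subst (1 2) cinner_commute) (simp add: cin)
  have nrm: "norm (\<gamma> (\<gamma>s x)) \<le> norm x" for x
    using \<gamma>_contraction(3)[OF \<gamma>s_in] norm_\<gamma>s order_trans by blast
  show "clinear_on E D"
    unfolding D by (rule clinear_on_sqrt_on[OF closed_E lin]) (simp_all add: \<gamma>_contraction \<gamma>s_in nrm sym)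
  show "cinner (D x) (D y) = cinner x y - cinner (\<gamma>s x) (\<gamma>s y)" if "x \<in> E" "y \<in> E"
    unfolding D cin[symmetric] using that
    by (intro cinner_sqrt_on[OF closed_E lin]) (simp_all add: \<gamma>_contraction \<gamma>s_in nrm sym)
qed

section \<open>The isometry \<open>\<iota>\<close> on \<open>W\<close> and projections onto embedded
  spaces\<close>

lemma \<iota>_eq: "\<iota> w = (proj g w, \<gamma>s (proj E w), copy [] (D (proj E w)))"
  by (simp add: \<iota>_def \<gamma>s_def D_def E_def ES_def)

lemma \<iota>_sum:
  assumes "x \<in> g" "e \<in> E"
  shows "\<iota> (x + e) = (x, \<gamma>s e, copy [] (D e))"
proof -
  have "proj g (x + e) = x" "proj E (x + e) = e"
    by (rule proj_eqI; use assms in \<open>simp add: cinner_add_left E_orth subspaces\<close>)+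
  then show ?thesis
    by (simp add: \<iota>_eq)
qed

lemma csubspace_W: "csubspace W"
  using complex_vector.subspace_sums[OF subspaces(3,1)] by (simp add: W_def)

lemma W_intros: "x \<in> g \<Longrightarrow> x \<in> W" "e \<in> E \<Longrightarrow> e \<in> W" "x \<in> g \<Longrightarrow> e \<in> E \<Longrightarrow> x + e \<in> W"
  unfolding W_def mem_Collect_eq
  by (rule exI[of _ x], rule exI[of _ 0], simp add: subspaces complex_vector.subspace_0)
    (rule exI[of _ 0], rule exI[of _ e], simp add: subspaces complex_vector.subspace_0, blast)

lemma clinear_on_\<iota>: "clinear_on W \<iota>"
proof -
  have D: "x \<in> E \<Longrightarrow> y \<in> E \<Longrightarrow> D (x + y) = D x + D y" "x \<in> E \<Longrightarrow> D (a *\<^sub>C x) = a *\<^sub>C D x" for x y a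
    using clinear_on_D by (auto simp: clinear_on_def)
  show ?thesis
    by (auto simp: clinear_on_def \<iota>_eq proj_clinear[OF closed_g] proj_clinear[OF closed_E] proj_in[OF closed_E] D
        \<gamma>s_clinear copy_add copy_scaleC scaleC_prod_def)
qed

text \<open>By \<open>cinner_D\<close> the \<open>\<gamma>s\<close> and \<open>D\<close> components
  together restore the inner product of \<open>E\<close>; cross terms with \<open>g\<close> vanish
  by orthogonality.\<close>

lemma cinner_\<iota>:
  assumes "v \<in> W" "w \<in> W"
  shows "cinner (\<iota> v) (\<iota> w) = cinner v w"
  using assms
  by (auto simp: W_def \<iota>_sum cinner_prod_def cinner_copy coord_copy cinner_D cinner_add_left
      cinner_add_right E_orth)

lemma inj_on_\<iota>: "inj_on \<iota> W"
proof (rule inj_onI)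
  fix v w assume vw: "v \<in> W" "w \<in> W" "\<iota> v = \<iota> w"
  show "v = w"
    by (rule csubspace_orthogonal_unique[OF csubspace_W vw(1,2)])
      (use vw in \<open>simp add: cinner_\<iota>[symmetric]\<close>)
qed

text \<open>The zero third component removes \<open>D\<close>, and the \<open>\<gamma>s\<close>
  component moves across to \<open>\<gamma>P y\<close>. Thus the pairing takes place inside
  \<open>W\<close>.\<close>

lemma cinner_pair_\<iota>:
  assumes "w \<in> W" "x \<in> g"
  shows "cinner (x, y, 0) (\<iota> w) = cinner (x + \<gamma>P y) w"
proof -
  obtain v e where w: "w = v + e" "v \<in> g" "e \<in> E"
    using assms(1) by (auto simp: W_def)
  have "cinner (\<gamma>P y) w = cinner (\<gamma>P y) e"
    using w by (simp add: cinner_add_right E_orth \<gamma>P_in)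
  moreover have "cinner x w = cinner x v"
    using w assms(2) by (simp add: cinner_add_right E_orth)
  ultimately show ?thesis
    using w by (simp add: \<iota>_sum cinner_prod_def cinner_add_left cinner_\<gamma>P)
qed

text \<open>By \<open>cinner_pair_\<iota>\<close> and the isometry of \<open>\<iota>\<close> the
  projection is computed before embedding. This gives the output maps of the extension and, with
  \<open>x = 0\<close>, also \<open>\<Gamma>\<close>.\<close>

lemma proj_\<iota>_image:
  assumes Y: "closed_csubspace Y" "Y \<subseteq> W" and x: "x \<in> g"
  shows "proj (\<iota> ` Y) (x, y, 0) = \<iota> (proj Y (x + \<gamma>P y))"
proof (rule proj_eqI)
  have "csubspace Y"
    using Y by (simp add: closed_csubspace_def)
  then show "csubspace (\<iota> ` Y)"
    by (rule csubspace_image[OF clinear_on_subset[OF clinear_on_\<iota> Y(2)]])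
  have pY: "proj Y (x + \<gamma>P y) \<in> Y"
    by (rule proj_in[OF Y(1)])
  then show "\<iota> (proj Y (x + \<gamma>P y)) \<in> \<iota> ` Y"
    by simp
  fix z assume "z \<in> \<iota> ` Y"
  then obtain w where w: "w \<in> Y" "z = \<iota> w"
    by blast
  have "cinner (x, y, 0) z = cinner (x + \<gamma>P y) w"
    using w Y x by (auto simp: cinner_pair_\<iota>)
  also have "\<dots> = cinner (\<iota> (proj Y (x + \<gamma>P y))) z"
    using w Y pY by (simp add: cinner_\<iota> subset_iff cinner_proj[OF Y(1)])
  finally show "cinner (x, y, 0) z = cinner (\<iota> (proj Y (x + \<gamma>P y))) z" .
qed

lemma embed_K_clinear: "clinear_on S embed_K"
  by (simp add: clinear_on_def embed_K_def scaleC_prod_def)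

lemma proj_embed_K_image:
  assumes Y: "closed_csubspace Y"
  shows "proj (embed_K ` Y) (embed_K y) = embed_K (proj Y y)"
proof (rule proj_eqI)
  show "csubspace (embed_K ` Y)"
    using Y by (intro csubspace_image embed_K_clinear) (simp add: closed_csubspace_def)
  show "embed_K (proj Y y) \<in> embed_K ` Y"
    by (intro imageI proj_in[OF Y])
  show "cinner (embed_K y) z = cinner (embed_K (proj Y y)) z" if "z \<in> embed_K ` Y" for z
    using that by (auto simp: embed_K_def cinner_prod_def cinner_proj[OF Y])
qed

section \<open>Adjoints of the letter operators of the extension\<close>

definition H :: "('g \<times> 'k \<times> ('d list, 'g) l2sum) set"
  where "H = g \<times> K \<times> copies (closure (D ` E))"
definition "V f = \<iota> (VG (map_l2sum fst f))
  + (0, VK (map_l2sum (\<lambda>v. fst (snd v)) f), row_shift (map_l2sum (\<lambda>v. snd (snd v)) f))"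

lemma gamma_extension_eq:
  "gamma_extension (G, VG, g) \<gamma> (K, VK, k) = (H, V, g \<times> k \<times> {0})"
  by (simp add: H_def V_def D_def E_def \<iota>_def fun_eq_iff)

lemma csubspace_copies_defect: "csubspace (copies (closure (D ` E)) :: ('d list, 'g) l2sum set)"
proof (rule csubspace_copies)
  \<comment> \<open>The range of \<open>D\<close> on \<open>E\<close> is its own span by linearity,
    so its closure is a closed linear span.\<close>
  have "cspan (D ` E) = D ` E"
    using csubspace_image[OF clinear_on_D subspaces(1)] by (rule complex_vector.span_eq_iff[THEN iffD2])
  then have "closure (D ` E) = cspan_closure (D ` E)"
    by (simp only: cspan_closure_def)
  then show "csubspace (closure (D ` E))"
    using closed_csubspace_cspan_closure[of "D ` E"] by (simp add: closed_csubspace_def)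
qed

lemma csubspace_H: "csubspace H"
  unfolding H_def
  by (intro csubspace_Times csubspace_copies_defect subspaces process_subspaces(3)[OF K])

lemma in_H: "x \<in> g \<Longrightarrow> y \<in> K \<Longrightarrow> (x, y, 0) \<in> H"
  using complex_vector.subspace_0[OF csubspace_copies_defect] by (simp add: H_def)

lemma embed_K_in_H: "y \<in> K \<Longrightarrow> embed_K y \<in> H"
  by (simp add: embed_K_def in_H subspaces complex_vector.subspace_0)

lemma W_subset: "W \<subseteq> cspan_closure (g \<union> VG ` copies g)"
proof -
  have "x + e \<in> cspan_closure (g \<union> VG ` copies g)" if "x \<in> g" "e \<in> E" for x e
  proof (rule complex_vector.subspace_add)
    show "csubspace (cspan_closure (g \<union> VG ` copies g))"
      using closed_csubspace_cspan_closure by (auto simp: closed_csubspace_def)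
  qed (use that in \<open>auto simp: E_def ominus_def intro: cspan_closure_base\<close>)
  then show ?thesis
    by (auto simp: W_def)
qed

text \<open>Pairing with a vector whose third component is zero removes both the row shift and the
  \<open>D\<close> component of \<open>\<iota>\<close>; the \<open>\<gamma>s\<close> component
  becomes a pairing with \<open>\<gamma>P y\<close> in \<open>G\<close>.\<close>

lemma adj_letter_op_V:
  assumes x: "x \<in> g"
  shows "adj_on H (letter_op V j) (x, y, 0) =
    (adj_on G (letter_op VG j) (\<gamma>P y) + adj_on G (letter_op VG j) x,
     adj_on K (letter_op VK j) y, 0)"
proof (rule adj_on_eqI[OF csubspace_H])
  let ?a = "adj_on G (letter_op VG j)"
  \<comment> \<open>Coinvariance keeps the first component of the candidate in \<open>g\<close>, as
    membership in \<open>H\<close> demands.\<close>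
  have "?a e \<in> g" if "e \<in> W" for e
    using adj_letter_op_in_state_space[OF G] W_subset that by blast
  then have "?a (\<gamma>P y) + ?a x \<in> g"
    using W_intros x \<gamma>P_in by (intro complex_vector.subspace_add subspaces) auto
  then show "(?a (\<gamma>P y) + ?a x, adj_on K (letter_op VK j) y, 0) \<in> H"
    by (intro in_H adj_letter_op_in[OF K])
  fix z assume "z \<in> H"
  then obtain a b s where z: "z = (a, b, s)" "a \<in> g" "b \<in> K"
    by (auto simp: H_def)
  have aG: "a \<in> G"
    using z process_subspaces[OF G] by blast
  have 1: "norm (fst v) \<le> norm v" "norm (fst (snd v)) \<le> norm v" "norm (snd (snd v)) \<le> norm v"
    for v :: "'g \<times> 'k \<times> ('d list, 'g) l2sum"
    using norm_fst_le order_trans[OF norm_fst_le norm_snd_le] order_trans[OF norm_snd_le norm_snd_le]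
    by (metis prod.collapse)+
  have Vz: "letter_op V j z = \<iota> (letter_op VG j a) + (0, letter_op VK j b, row_shift (copy j s))"
    by (simp add: letter_op_def V_def map_l2sum_copy 1 z)
  \<comment> \<open>The projections in \<open>\<iota>_eq\<close> are absorbed by the test vectors
    \<open>x\<close> in \<open>g\<close> and \<open>\<gamma>P y\<close> in \<open>E\<close>.\<close>
  have "cinner (letter_op V j z) (x, y, 0) = cinner (letter_op VG j a) x
      + cinner (letter_op VG j a) (\<gamma>P y) + cinner (letter_op VK j b) y"
    by (simp add: Vz \<iota>_eq cinner_prod_def cinner_add_left cinner_proj[OF closed_g x]
        cinner_\<gamma>P(2)[symmetric] cinner_proj[OF closed_E \<gamma>P_in])
  also have "\<dots> = cinner z (?a (\<gamma>P y) + ?a x, adj_on K (letter_op VK j) y, 0)"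
    using z aG
    by (simp add: cinner_adj_letter_op[OF G] cinner_adj_letter_op[OF K] cinner_prod_def cinner_add_right)
  finally show "cinner (letter_op V j z) (x, y, 0)
    = cinner z (?a (\<gamma>P y) + ?a x, adj_on K (letter_op VK j) y, 0)" .
qed

section \<open>Consequences of the support conditions\<close>

context
  fixes U0G Y0K
  assumes U0G: "U0G \<subseteq> E" "closed_csubspace U0G"
    and Y0K: "closed_csubspace Y0K"
    and left: "left_support H (embed_K ` ES) (embedded_gamma (G, VG, g) \<gamma> (K, VK, k)) (\<iota> ` U0G)"
    and right: "right_support H (embed_K ` ES) (embedded_gamma (G, VG, g) \<gamma> (K, VK, k))
      (embed_K ` Y0K)"
begin

lemma embedded_gamma_proj:
  "embedded_gamma (G, VG, g) \<gamma> (K, VK, k) (proj (embed_K ` ES) (embed_K y)) = \<iota> (\<gamma>P y)"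
  by (simp only: proj_embed_K_image[OF closed_ES])
    (simp add: embed_K_def embedded_gamma_def \<iota>_def \<gamma>P_def del: embed_G.simps)

text \<open>Left support makes \<open>\<iota> (\<gamma>P y)\<close> a fixed vector of the projection
  onto the embedded input space; injectivity of \<open>\<iota>\<close> on \<open>W\<close> brings
  the membership back to \<open>G\<close>.\<close>

lemma \<gamma>P_in_U0G:
  assumes y: "y \<in> K"
  shows "\<gamma>P y \<in> U0G"
proof -
  have "proj (\<iota> ` U0G) (\<iota> (\<gamma>P y)) = \<iota> (\<gamma>P y)" and "closed_csubspace (\<iota> ` U0G)"
    using left embed_K_in_H[OF y] unfolding left_support_def embedded_gamma_proj[symmetric] by auto
  then have "\<iota> (\<gamma>P y) \<in> \<iota> ` U0G"
    using proj_in[of "\<iota> ` U0G" "\<iota> (\<gamma>P y)"] by simp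
  moreover have "U0G \<subseteq> W"
    using U0G W_intros by auto
  ultimately show ?thesis
    using inj_on_image_mem_iff[OF inj_on_\<iota>] W_intros(2)[OF \<gamma>P_in] by blast
qed

text \<open>Right support at \<open>embed_K y\<close>, with \<open>\<iota>\<close> cancelled by
  injectivity on \<open>W\<close>.\<close>

lemma \<gamma>P_proj:
  assumes y: "y \<in> K"
  shows "\<gamma>P (proj Y0K y) = \<gamma>P y"
proof -
  have "\<iota> (\<gamma>P y) = \<iota> (\<gamma>P (proj Y0K y))"
    unfolding embedded_gamma_proj[symmetric]
    using right embed_K_in_H[OF y] unfolding right_support_def
    by (simp add: proj_embed_K_image[OF Y0K])
  then show ?thesis
    using inj_onD[OF inj_on_\<iota>] W_intros(2)[OF \<gamma>P_in] by metis
qed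

text \<open>\<open>proj_\<iota>_image\<close> with \<open>x = 0\<close> reduces the projection to
  one in \<open>G\<close>; right support then replaces \<open>proj Y0K y\<close> by
  \<open>y\<close>, and left support removes the projection onto \<open>U0G\<close>.\<close>

lemma \<Gamma>_proj:
  assumes y: "y \<in> K"
  shows "inv_into U0G \<iota> (proj (\<iota> ` U0G) (embed_K (proj Y0K y))) = \<gamma>P y"
proof -
  have UW: "U0G \<subseteq> W"
    using U0G W_intros by auto
  have "proj (\<iota> ` U0G) (embed_K (proj Y0K y)) = \<iota> (proj U0G (\<gamma>P y))"
    using proj_\<iota>_image[OF U0G(2) UW, of 0 "proj Y0K y"]
    by (simp add: embed_K_def \<gamma>P_proj[OF y] subspaces complex_vector.subspace_0)
  also have "\<dots> = \<iota> (\<gamma>P y)"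
    by (simp add: proj_self U0G \<gamma>P_in_U0G[OF y])
  finally show ?thesis
    using inv_into_f_f[OF inj_on_subset[OF inj_on_\<iota> UW] \<gamma>P_in_U0G[OF y]] by simp
qed

end

end

text \<open>System I of the cascade is \<open>K\<close>, so its states have the \<open>k\<close>
  part first, while the extension stores the \<open>g\<close> part first; hence the swap in the
  state identification. In \<open>\<Gamma>\<close>, \<open>inv_into\<close> undoes
  \<open>\<iota>\<close> so that the values lie in \<open>U0G\<close> itself.\<close>

theorem theorem5p1:
  fixes G g U0G Y0G :: "'g::chilbert_space set"
    and K k U0K Y0K :: "'k::chilbert_space set"
    and VG :: "('d::countable, 'g) l2sum \<Rightarrow> 'g"
    and VK :: "('d, 'k) l2sum \<Rightarrow> 'k"
    and \<gamma> :: "'k \<Rightarrow> 'g"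
    and \<Gamma> :: "'k \<Rightarrow> 'g"
    and H h :: "('g \<times> 'k \<times> ('d list, 'g) l2sum) set"
  assumes G: "is_process (G, VG, g)"
    and K: "is_process (K, VK, k)"
    and \<gamma>: "contraction_on (defect_space_star (K, VK, k)) (defect_space (G, VG, g)) \<gamma>"
    and H: "(H, V, h) = gamma_extension (G, VG, g) \<gamma> (K, VK, k)"
    and U0G: "input_space (G, VG, g) U0G"
    and Y0G: "output_space (G, VG, g) Y0G"
    and U0K: "input_space (K, VK, k) U0K"
    and Y0K: "output_space (K, VK, k) Y0K"
    and sG: "(AG, BG, CG, DG) = structure_maps (G, VG, g) U0G Y0G"
    and sK: "(AK, BK, CK, DK) = structure_maps (K, VK, k) U0K Y0K"
    and \<iota>: "\<iota> = embed_G (G, VG, g) \<gamma> (K, VK, k)"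
    and sH: "(A, B, C, D) = structure_maps (H, V, h) (embed_K ` U0K) (\<iota> ` Y0G)"
    and \<Gamma>: "\<Gamma> = restrict (\<lambda>y. inv_into U0G \<iota> (proj (\<iota> ` U0G) (embed_K y))) Y0K"
    and left: "left_support H (embed_K ` defect_space_star (K, VK, k))
      (embedded_gamma (G, VG, g) \<gamma> (K, VK, k)) (\<iota> ` U0G)"
    and right: "right_support H (embed_K ` defect_space_star (K, VK, k))
      (embedded_gamma (G, VG, g) \<gamma> (K, VK, k)) (embed_K ` Y0K)"
  shows "same_structure_maps (\<lambda>(y, x). (x, y, 0)) embed_K \<iota> (k \<times> g) U0K
      (A, B, C, D) (cascade \<Gamma> (AK, BK, CK, DK) (AG, BG, CG, DG)) \<and>
    (\<forall>j. \<forall>y\<in>k. \<forall>x\<in>g. A j (x, y, 0) = (BG j (\<Gamma> (CK y)) + AG j x, AK j y, 0)) \<and>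
    (\<forall>j. \<forall>u\<in>U0K. B j (embed_K u) = (BG j (\<Gamma> (DK u)), BK j u, 0)) \<and>
    (\<forall>y\<in>k. \<forall>x\<in>g. C (x, y, 0) = \<iota> (DG (\<Gamma> (CK y)) + CG x)) \<and>
    (\<forall>u\<in>U0K. D (embed_K u) = \<iota> (DG (\<Gamma> (DK u))))"
proof -
  interpret X: process_extension G g VG K k VK \<gamma>
    by (rule process_extension.intro[OF G K \<gamma>])
  have \<iota>: "\<iota> = X.\<iota>"
    by (simp only: \<iota> X.\<iota>_def)
  have Hd: "H = X.H" "V = X.V" "h = g \<times> k \<times> {0}"
    using H X.gamma_extension_eq by auto
  have U0G': "U0G \<subseteq> X.E" "closed_csubspace U0G"
    using U0G by (auto simp: X.E_def)
  have Y0G': "closed_csubspace Y0G" "Y0G \<subseteq> X.W"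
    using Y0G by (auto simp: X.E_def X.W_def)
  have Y0K': "closed_csubspace Y0K"
    using Y0K by simp
  have kK: "k \<subseteq> K"
    by (rule process_subspaces(5)[OF K])
  have UK: "U0K \<subseteq> K"
    using U0K cspan_closure_process_subset[OF K] by (auto simp: ominus_def)
  note supp = U0G' Y0K' left[unfolded Hd \<iota> X.ES_def[symmetric]] right[unfolded Hd X.ES_def[symmetric]]
  \<comment> \<open>\<open>CK\<close> and \<open>DK\<close> both project onto \<open>Y0K\<close>, so
    this evaluates \<open>\<Gamma>\<close> after either. Membership in \<open>U0G\<close> matters
    because \<open>BG\<close> and \<open>DG\<close> are given by \<open>restrict\<close> to that
    space.\<close>
  have \<Gamma>P: "\<Gamma> (proj Y0K y) = X.\<gamma>P y" and UG: "X.\<gamma>P y \<in> U0G" if "y \<in> K" for y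
    using X.\<Gamma>_proj[OF supp that] X.\<gamma>P_in_U0G[OF supp that] proj_in[OF Y0K'] by (simp_all add: \<Gamma> \<iota>)
  have 0: "0 \<in> g"
    using X.subspaces complex_vector.subspace_0 by blast
  have maps:
    "A = (\<lambda>j. restrict (adj_on X.H (letter_op X.V j)) (g \<times> k \<times> {0}))"
    "B = (\<lambda>j. restrict (adj_on X.H (letter_op X.V j)) (embed_K ` U0K))"
    "C = restrict (proj (X.\<iota> ` Y0G)) (g \<times> k \<times> {0})"
    "D = restrict (proj (X.\<iota> ` Y0G)) (embed_K ` U0K)"
    using sH by (auto simp: Hd \<iota>)
  have A: "A j (x, y, 0) = (BG j (\<Gamma> (CK y)) + AG j x, AK j y, 0)" if "y \<in> k" "x \<in> g" for j x y
    using that sG sK UG[of y] \<Gamma>P[of y] kK by (auto simp: maps X.adj_letter_op_V)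
  have B: "B j (embed_K u) = (BG j (\<Gamma> (DK u)), BK j u, 0)" if "u \<in> U0K" for j u
  proof -
    \<comment> \<open>Inputs are the case \<open>x = 0\<close> of \<open>adj_letter_op_V\<close>, so
      its summand for \<open>x\<close> has to vanish.\<close>
    have "adj_on G (letter_op VG j) 0 = 0"
      using adj_letter_op_add[OF G, of j 0 0] by simp
    then show ?thesis
      using that sG sK UG[of u] \<Gamma>P[of u] UK X.adj_letter_op_V[OF 0, of j u]
      by (auto simp: maps embed_K_def)
  qed
  have C: "C (x, y, 0) = \<iota> (DG (\<Gamma> (CK y)) + CG x)" if "y \<in> k" "x \<in> g" for x y
    using that sG sK UG[of y] \<Gamma>P[of y] kK
    by (auto simp: maps \<iota> X.proj_\<iota>_image[OF Y0G'] proj_clinear[OF Y0G'(1)] add.commute)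
  have D: "D (embed_K u) = \<iota> (DG (\<Gamma> (DK u)))" if "u \<in> U0K" for u
    using that sG sK UG[of u] \<Gamma>P[of u] UK X.proj_\<iota>_image[OF Y0G' 0, of u]
    by (auto simp: maps \<iota> embed_K_def)
  show ?thesis
    using A B C D by auto
qed

end
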